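(* The set $\{1324,2413,3142,4231\}$ of $4$-point permutations is not quasirandom-forcing.
   Context: Permutations are written in one-line notation $\pi(1)\pi(2)\cdots\pi(k)$. Pattern density $d(\sigma,\pi)$: probability that a uniformly random $|\sigma|$-subset of positions of $\pi$ induces the pattern $\sigma$. A set $S$ of permutations is quasirandom-forcing if every sequence of permutations with sizes tending to infinity and $d(\sigma,\pi_n)\to1/|\sigma|!$ for all $\sigma\in S$ has $d(\sigma,\pi_n)\to1/|\sigma|!$ for all permutations $\sigma$. *)

theory Defs
  imports "HOL-Analysis.Analysis" "HOL-Combinatorics.Multiset_Permutations"
begin

text \<open>
  A permutation of \<open>{1..k}\<close> is represented by its one-line notation, the list
  \<open>[\<pi>(1), \<dots>, \<pi>(k)]\<close>; its size is the length of the list. List positions are counted from 0.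
\<close>

definition is_permutation :: "nat list \<Rightarrow> bool" where
  "is_permutation \<pi> \<longleftrightarrow> \<pi> \<in> permutations_of_set {1..length \<pi>}"

definition order_isomorphic :: "nat list \<Rightarrow> nat list \<Rightarrow> bool" where
  "order_isomorphic xs ys \<longleftrightarrow> length xs = length ys \<and>
     (\<forall>i<length xs. \<forall>j<length xs. xs ! i < xs ! j \<longleftrightarrow> ys ! i < ys ! j)"

definition induces_pattern :: "nat list \<Rightarrow> nat set \<Rightarrow> nat list \<Rightarrow> bool" where
  "induces_pattern \<pi> I \<sigma> \<longleftrightarrow> order_isomorphic (nths \<pi> I) \<sigma>"

text \<open>
  For \<open>length \<sigma> > length \<pi>\<close> there is no set of positions to choose, and the quotient is \<open>0 / 0 = 0\<close>.
\<close>

definition pattern_density :: "nat list \<Rightarrow> nat list \<Rightarrow> real" where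
  "pattern_density \<sigma> \<pi> =
     real (card {I. I \<subseteq> {..<length \<pi>} \<and> card I = length \<sigma> \<and> induces_pattern \<pi> I \<sigma>}) /
     real (card {I. I \<subseteq> {..<length \<pi>} \<and> card I = length \<sigma>})"

definition quasirandom_forcing :: "nat list set \<Rightarrow> bool" where
  "quasirandom_forcing S \<longleftrightarrow>
     (\<forall>\<pi> :: nat \<Rightarrow> nat list.
        (\<forall>n. is_permutation (\<pi> n)) \<longrightarrow>
        filterlim (\<lambda>n. length (\<pi> n)) at_top sequentially \<longrightarrow>
        (\<forall>\<sigma>\<in>S. (\<lambda>n. pattern_density \<sigma> (\<pi> n)) \<longlonglongrightarrow> 1 / fact (length \<sigma>)) \<longrightarrow>
        (\<forall>\<sigma>. is_permutation \<sigma> \<longrightarrow>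
           (\<lambda>n. pattern_density \<sigma> (\<pi> n)) \<longlonglongrightarrow> 1 / fact (length \<sigma>)))"

end

theory Submission
  imports Defs
begin

text \<open>
  The sum of the four densities is stationary at the uniform permuton, and smooth perturbations do not
  seem to yield a counterexample; the following one has structure on two scales.
  Let \<open>\<nu>\<close> be the direct sum of an increasing, three decreasing and an increasing block of masses
  1, 1, 2, 1, 1, and let the core \<open>C\<close> consist of a copy of \<open>\<nu>\<close> in every cell of a \<open>12 \<times> 12\<close> grid,
  with multiplicity 7 in the four corners and 8 elsewhere. Two points of \<open>C\<close> in different columns are
  compared by their columns and otherwise by the position inside \<open>\<nu>\<close>, similarly for rows; hence
  the densities of \<open>C\<close> are linear in those of \<open>\<nu>\<close> and can be computed. In \<open>C\<close> the patterns 2413 and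
  3142 have the same density, which exceeds \<open>1/24\<close> and the densities of 1324 and 4231.

  Now take \<open>R \<oplus> (P \<ominus> C \<ominus> P')\<close> with \<open>R\<close> increasing and \<open>P\<close>, \<open>P'\<close> decreasing. The simple patterns 2413
  and 3142 occur only inside \<open>C\<close>, so they determine the total mass; 1324 also profits from \<open>R\<close>, and
  this determines the mass of \<open>R\<close>; finally 4231 also profits from \<open>P\<close> and \<open>P'\<close>, which prescribes the sum
  and the product of their masses. The grid is chosen such that the resulting quadratic equation has
  two nonnegative solutions. The density of 12 is not \<open>1/2\<close>.
\<close>

section \<open>Patterns in planar point sets\<close>

text \<open>Finite sets with distinct coordinates stand for permutations up to increasing changes of
  the two coordinates. They can be shifted, united and nested without renumbering.\<close>

definition point_set :: "(nat \<times> nat) set \<Rightarrow> bool" where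
  "point_set Q \<longleftrightarrow> finite Q \<and> inj_on fst Q \<and> inj_on snd Q"

text \<open>Reading from left to right turns each \<open>k\<close>-subset of a
  \<open>point_set\<close> into exactly one list, so counting lists counts subsets.\<close>

definition sorted_lists :: "(nat \<times> nat) set \<Rightarrow> nat \<Rightarrow> (nat \<times> nat) list set" where
  "sorted_lists Q k = {qs. set qs \<subseteq> Q \<and> sorted_wrt (<) (map fst qs) \<and> length qs = k}"

definition occs :: "(nat \<times> nat) set \<Rightarrow> nat list \<Rightarrow> (nat \<times> nat) list set" where
  "occs Q \<sigma> = {qs. set qs \<subseteq> Q \<and> sorted_wrt (<) (map fst qs) \<and> order_isomorphic (map snd qs) \<sigma>}"

definition occ :: "(nat \<times> nat) set \<Rightarrow> nat list \<Rightarrow> nat" where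
  "occ Q \<sigma> = card (occs Q \<sigma>)"

lemma order_isomorphicD:
  "order_isomorphic xs ys \<Longrightarrow> length xs = length ys"
  "order_isomorphic xs ys \<Longrightarrow> i < length ys \<Longrightarrow> j < length ys \<Longrightarrow> xs ! i < xs ! j \<longleftrightarrow> ys ! i < ys ! j"
  by (auto simp: order_isomorphic_def)

lemma order_isomorphic_map_cong:
  assumes "\<And>p q. p \<in> set qs \<Longrightarrow> q \<in> set qs \<Longrightarrow> f p < f q \<longleftrightarrow> g p < g q"
  shows "order_isomorphic (map f qs) \<sigma> \<longleftrightarrow> order_isomorphic (map g qs) \<sigma>"
  using assms by (simp add: order_isomorphic_def cong: conj_cong)

lemma order_isomorphic_sym: "order_isomorphic xs ys \<longleftrightarrow> order_isomorphic ys xs"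
  by (auto simp: order_isomorphic_def)

lemma order_isomorphic_trans: "order_isomorphic xs ys \<Longrightarrow> order_isomorphic ys zs \<Longrightarrow> order_isomorphic xs zs"
  by (auto simp: order_isomorphic_def)

lemma occs_subset_sorted_lists: "occs Q \<sigma> \<subseteq> sorted_lists Q (length \<sigma>)"
  by (auto simp: occs_def sorted_lists_def dest: order_isomorphicD(1))

lemma finite_sorted_lists: "finite Q \<Longrightarrow> finite (sorted_lists Q k)"
  by (rule finite_subset[OF _ finite_lists_length_eq[of Q k]]) (auto simp: sorted_lists_def)

lemma finite_occs: "finite Q \<Longrightarrow> finite (occs Q \<sigma>)"
  using finite_subset[OF occs_subset_sorted_lists finite_sorted_lists] by blast

section \<open>Lists of points and sets of positions\<close>

lemma sorted_list_of_points:
  assumes "point_set Q"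
  obtains xs where "set xs = Q" "distinct xs" "sorted_wrt (<) (map fst xs)" "length xs = card Q"
proof -
  let ?g = "the_inv_into Q fst"
  let ?xs = "map ?g (sorted_list_of_set (fst ` Q))"
  have fin: "finite Q" and inj: "inj_on fst Q" using assms by (auto simp: point_set_def)
  have m: "map fst ?xs = sorted_list_of_set (fst ` Q)"
    by (rule map_idI[of "sorted_list_of_set (fst ` Q)" "fst \<circ> ?g", simplified map_map[symmetric]])
      (use fin f_the_inv_into_f[OF inj] in auto)
  have s: "set ?xs = Q"
    using fin the_inv_into_f_f[OF inj] by (auto simp: image_image)
  have d: "distinct ?xs"
    by (metis m distinct_map distinct_sorted_list_of_set)
  have "length ?xs = card Q"
    using fin inj by (simp add: card_image)
  then show thesis
    using that[of ?xs] s d m by (metis strict_sorted_list_of_set)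
qed

lemma sorted_lists_eqI:
  assumes "point_set Q" "set xs \<subseteq> Q" "set ys = set xs"
    "sorted_wrt (<) (map fst xs)" "sorted_wrt (<) (map fst ys)"
  shows "xs = ys"
proof -
  have "map fst xs = map fst ys"
    by (rule strict_sorted_equal) (use assms in auto)
  moreover have "inj_on fst (set xs \<union> set ys)"
    using assms by (auto simp: point_set_def intro: inj_on_subset)
  ultimately show ?thesis by (simp add: inj_on_map_eq_map)
qed

text \<open>Translates the position sets in \<open>pattern_density\<close> into lists of points; the
  inverse collects the positions of the points in a list.\<close>

lemma bij_betw_nths_sorted_lists:
  assumes "point_set Q" "set xs = Q" "distinct xs" "sorted_wrt (<) (map fst xs)"
  shows "bij_betw (nths xs) {I. I \<subseteq> {..<length xs} \<and> card I = k} (sorted_lists Q k)"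
proof (rule bij_betw_imageI)
  show "inj_on (nths xs) {I. I \<subseteq> {..<length xs} \<and> card I = k}"
  proof (rule inj_onI)
    fix I J assume I: "I \<in> {I. I \<subseteq> {..<length xs} \<and> card I = k}" and J: "J \<in> {I. I \<subseteq> {..<length xs} \<and> card I = k}"
      and eq: "nths xs I = nths xs J"
    have "(!) xs ` H = set (nths xs H)" if "H \<subseteq> {..<length xs}" for H
      using that by (auto simp: set_nths)
    then have "(!) xs ` I = (!) xs ` J"
      using I J eq by simp
    moreover have "inj_on ((!) xs) {..<length xs}"
      using assms(3) by (auto intro!: inj_on_nth)
    ultimately show "I = J"
      using I J by (auto simp: inj_on_image_eq_iff)
  qed
  have len: "length (nths xs I) = card I" if "I \<subseteq> {..<length xs}" for I
  proof -
    have "{i. i < length xs \<and> i \<in> I} = I" using that by auto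
    then show ?thesis by (simp add: length_nths)
  qed
  have srt: "sorted_wrt (<) (map fst (nths xs I))" for I
  proof -
    have "sorted_wrt (\<lambda>p q. fst p < fst q) (nths xs I)"
      using assms(4) by (induction xs arbitrary: I) (auto simp: nths_Cons sorted_wrt_map dest: in_set_nthsD)
    then show ?thesis by (simp add: sorted_wrt_map)
  qed
  show "nths xs ` {I. I \<subseteq> {..<length xs} \<and> card I = k} = sorted_lists Q k"
  proof (intro equalityI subsetI)
    fix qs assume "qs \<in> nths xs ` {I. I \<subseteq> {..<length xs} \<and> card I = k}"
    then show "qs \<in> sorted_lists Q k"
      using len srt assms(2) by (auto simp: sorted_lists_def dest: in_set_nthsD)
  next
    fix qs assume qs: "qs \<in> sorted_lists Q k"
    define I where "I = {i. i < length xs \<and> xs ! i \<in> set qs}"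
    have set: "set (nths xs I) = set qs"
    proof
      show "set qs \<subseteq> set (nths xs I)"
      proof
        fix p assume p: "p \<in> set qs"
        then have "p \<in> set xs" using qs assms(2) by (auto simp: sorted_lists_def)
        then obtain i where "i < length xs" "xs ! i = p" by (auto simp: in_set_conv_nth)
        with p show "p \<in> set (nths xs I)" by (auto simp: set_nths I_def)
      qed
    qed (auto simp: set_nths I_def)
    have "qs = nths xs I"
      by (rule sorted_lists_eqI[OF assms(1)]) (use qs set srt in \<open>auto simp: sorted_lists_def\<close>)
    moreover have "I \<subseteq> {..<length xs}" by (auto simp: I_def)
    ultimately show "qs \<in> nths xs ` {I. I \<subseteq> {..<length xs} \<and> card I = k}"
      using len[of I] qs by (auto simp: sorted_lists_def)
  qed
qed

lemma card_sorted_lists: "point_set Q \<Longrightarrow> card (sorted_lists Q k) = card Q choose k"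
proof -
  assume Q: "point_set Q"
  obtain xs where xs: "set xs = Q" "distinct xs" "sorted_wrt (<) (map fst xs)" "length xs = card Q"
    using sorted_list_of_points[OF Q] .
  show ?thesis
    using bij_betw_same_card[OF bij_betw_nths_sorted_lists[OF Q xs(1-3), of k]] n_subsets[of "{..<length xs}" k] xs(4)
    by simp
qed

lemma permutation_of_point_set:
  assumes Q: "point_set Q"
  shows "\<exists>\<pi>. is_permutation \<pi> \<and> length \<pi> = card Q \<and>
    (\<forall>\<sigma>. pattern_density \<sigma> \<pi> = real (occ Q \<sigma>) / real (card Q choose length \<sigma>))"
proof -
  obtain xs where xs: "set xs = Q" "distinct xs" "sorted_wrt (<) (map fst xs)" "length xs = card Q"
    using sorted_list_of_points[OF Q] .
  have fin: "finite Q" using Q by (simp add: point_set_def)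
  \<comment> \<open>Heights are replaced by their ranks. The inequality is weak, so that the lowest
    point gets rank 1, as \<open>is_permutation\<close> requires.\<close>
  define rk where "rk p = card {q \<in> Q. snd q \<le> snd p}" for p :: "nat \<times> nat"
  have rk_less: "rk p < rk q" if "p \<in> Q" "q \<in> Q" "snd p < snd q" for p q
  proof -
    have "q \<in> {q' \<in> Q. snd q' \<le> snd q} - {q' \<in> Q. snd q' \<le> snd p}" using that by simp
    then have "{q' \<in> Q. snd q' \<le> snd p} \<subset> {q' \<in> Q. snd q' \<le> snd q}" using that by fastforce
    then show ?thesis unfolding rk_def using fin by (simp add: psubset_card_mono)
  qed
  have rk_iff: "rk p < rk q \<longleftrightarrow> snd p < snd q" if "p \<in> Q" "q \<in> Q" for p q
    by (metis Q inj_onD less_irrefl linorder_less_linear not_less_iff_gr_or_eq point_set_def rk_less that)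
  have inj: "inj_on rk Q"
  proof (rule inj_onI)
    fix p q assume pq: "p \<in> Q" "q \<in> Q" "rk p = rk q"
    then have "snd p = snd q" using rk_less by (metis less_irrefl linorder_less_linear)
    with pq show "p = q" using Q by (auto simp: point_set_def dest: inj_onD)
  qed
  have "rk ` Q \<subseteq> {1..card Q}"
  proof
    fix y assume "y \<in> rk ` Q"
    then obtain p where p: "p \<in> Q" "y = rk p" by auto
    have "card {p} \<le> rk p" unfolding rk_def by (rule card_mono) (use p fin in auto)
    moreover have "rk p \<le> card Q" unfolding rk_def by (rule card_mono) (use fin in auto)
    ultimately show "y \<in> {1..card Q}" using p by auto
  qed
  then have img: "rk ` Q = {1..card Q}"
    by (rule card_subset_eq[rotated]) (auto simp: card_image inj)
  define \<pi> where "\<pi> = map rk xs"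
  have len: "length \<pi> = card Q" by (simp add: \<pi>_def xs)
  have perm: "is_permutation \<pi>"
    unfolding is_permutation_def len using img inj xs
    by (auto simp: \<pi>_def permutations_of_set_def distinct_map)
  have "card {I. I \<subseteq> {..<length \<pi>} \<and> card I = length \<sigma> \<and> induces_pattern \<pi> I \<sigma>} = occ Q \<sigma>" for \<sigma>
  proof -
    let ?S = "{I. I \<subseteq> {..<length xs} \<and> card I = length \<sigma>}"
    have bij: "bij_betw (nths xs) ?S (sorted_lists Q (length \<sigma>))"
      by (rule bij_betw_nths_sorted_lists[OF Q xs(1-3)])
    have iso: "order_isomorphic (map rk qs) \<sigma> \<longleftrightarrow> order_isomorphic (map snd qs) \<sigma>" if "set qs \<subseteq> Q" for qs
      by (rule order_isomorphic_map_cong) (use that rk_iff in blast)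
    have ind: "induces_pattern \<pi> I \<sigma> \<longleftrightarrow> order_isomorphic (map snd (nths xs I)) \<sigma>" for I
      unfolding induces_pattern_def \<pi>_def nths_map
      by (rule iso) (use xs(1) in \<open>auto dest: in_set_nthsD\<close>)
    have "bij_betw (nths xs) {I \<in> ?S. order_isomorphic (map snd (nths xs I)) \<sigma>}
        {qs \<in> sorted_lists Q (length \<sigma>). order_isomorphic (map snd qs) \<sigma>}"
      using bij by (auto simp: bij_betw_def inj_on_def)
    moreover have "{qs \<in> sorted_lists Q (length \<sigma>). order_isomorphic (map snd qs) \<sigma>} = occs Q \<sigma>"
      by (auto simp: sorted_lists_def occs_def dest: order_isomorphicD(1))
    moreover have "{I \<in> ?S. order_isomorphic (map snd (nths xs I)) \<sigma>} =
        {I. I \<subseteq> {..<length \<pi>} \<and> card I = length \<sigma> \<and> induces_pattern \<pi> I \<sigma>}"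
      by (auto simp: ind len xs(4))
    ultimately show ?thesis by (auto simp: occ_def dest: bij_betw_same_card)
  qed
  then have "pattern_density \<sigma> \<pi> = real (occ Q \<sigma>) / real (card Q choose length \<sigma>)" for \<sigma>
    unfolding pattern_density_def using n_subsets[of "{..<length \<pi>}" "length \<sigma>"] len by simp
  with perm len show ?thesis by blast
qed

section \<open>Direct sums, skew sums and monotone point sets\<close>

text \<open>A cut after \<open>i\<close> entries exhibits a direct sum for \<open>(<)\<close> and a
  skew sum for \<open>(>)\<close>. The two trivial cuts always qualify.\<close>

definition separates :: "(nat \<Rightarrow> nat \<Rightarrow> bool) \<Rightarrow> nat \<Rightarrow> nat list \<Rightarrow> bool" where
  "separates R i \<sigma> \<longleftrightarrow> (\<forall>u\<in>set (take i \<sigma>). \<forall>v\<in>set (drop i \<sigma>). R u v)"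

text \<open>Comparisons across the cut are all decided by \<open>R\<close>, so only those within the
  two pieces remain.\<close>

lemma order_isomorphic_append_iff:
  assumes R: "R = (<) \<or> R = (>)" and i: "length xs = i" and len: "length xs + length ys = length \<sigma>"
    and xy: "\<And>x y. x \<in> set xs \<Longrightarrow> y \<in> set ys \<Longrightarrow> R x y"
  shows "order_isomorphic (xs @ ys) \<sigma> \<longleftrightarrow>
    separates R i \<sigma> \<and> order_isomorphic xs (take i \<sigma>) \<and> order_isomorphic ys (drop i \<sigma>)"
    (is "?L \<longleftrightarrow> ?S \<and> ?A \<and> ?B")
proof -
  have sep: "?S \<longleftrightarrow> (\<forall>a<i. \<forall>b<length ys. R (\<sigma> ! a) (\<sigma> ! (i + b)))"
    using i len by (auto simp: separates_def all_set_conv_all_nth)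
  have xyn: "R (xs ! a) (ys ! b)" if "a < i" "b < length ys" for a b
    using that xy[of "xs ! a" "ys ! b"] i by auto
  show ?thesis
  proof
    assume L: ?L
    have *: "(xs @ ys) ! a < (xs @ ys) ! b \<longleftrightarrow> \<sigma> ! a < \<sigma> ! b" if "a < length \<sigma>" "b < length \<sigma>" for a b
      using L that by (simp add: order_isomorphicD(2))
    have "?S" unfolding sep
    proof (intro allI impI)
      fix a b assume ab: "a < i" "b < length ys"
      then show "R (\<sigma> ! a) (\<sigma> ! (i + b))"
        using R *[of a "i + b"] *[of "i + b" a] xyn[of a b] i len by (auto simp: nth_append)
    qed
    moreover have "?A"
      unfolding order_isomorphic_def
    proof (intro conjI allI impI)
      fix a b assume "a < length xs" "b < length xs"
      then show "xs ! a < xs ! b \<longleftrightarrow> take i \<sigma> ! a < take i \<sigma> ! b"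
        using *[of a b] i len by (auto simp: nth_append)
    qed (use i len in auto)
    moreover have "?B"
      unfolding order_isomorphic_def
    proof (intro conjI allI impI)
      fix a b assume "a < length ys" "b < length ys"
      then show "ys ! a < ys ! b \<longleftrightarrow> drop i \<sigma> ! a < drop i \<sigma> ! b"
        using *[of "i + a" "i + b"] i len by (auto simp: nth_append)
    qed (use i len in auto)
    ultimately show "?S \<and> ?A \<and> ?B" by blast
  next
    assume H: "?S \<and> ?A \<and> ?B"
    show ?L unfolding order_isomorphic_def
    proof (intro conjI allI impI)
      fix a b assume ab: "a < length (xs @ ys)" "b < length (xs @ ys)"
      show "(xs @ ys) ! a < (xs @ ys) ! b \<longleftrightarrow> \<sigma> ! a < \<sigma> ! b"
      proof (cases "a < i"; cases "b < i")
        assume "a < i" "b < i"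
        then show ?thesis using H i len by (auto simp: order_isomorphic_def nth_append)
      next
        assume c: "a < i" "\<not> b < i"
        then have "R (\<sigma> ! a) (\<sigma> ! (i + (b - i)))" "R (xs ! a) (ys ! (b - i))"
          using H[unfolded sep, THEN conjunct1, rule_format, of a "b - i"] ab i xyn[of a "b - i"] by simp_all
        then show ?thesis using R c i by (auto simp: nth_append)
      next
        assume c: "\<not> a < i" "b < i"
        then have "R (\<sigma> ! b) (\<sigma> ! (i + (a - i)))" "R (xs ! b) (ys ! (a - i))"
          using H[unfolded sep, THEN conjunct1, rule_format, of b "a - i"] ab i xyn[of b "a - i"] by simp_all
        then show ?thesis using R c i by (auto simp: nth_append)
      next
        assume c: "\<not> a < i" "\<not> b < i"
        then have "ys ! (a - i) < ys ! (b - i) \<longleftrightarrow> drop i \<sigma> ! (a - i) < drop i \<sigma> ! (b - i)"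
          using H ab i by (auto simp: order_isomorphic_def)
        then show ?thesis using c i len ab by (auto simp: nth_append)
      qed
    qed (use len in auto)
  qed
qed

text \<open>All of \<open>A\<close> lies to the left of \<open>B\<close>, so an occurrence consists
  of points of \<open>A\<close> followed by points of \<open>B\<close>, and \<open>R\<close> forces
  the pattern to split at the same place.\<close>

lemma occ_Un:
  assumes fin: "finite A" "finite B" and R: "R = (<) \<or> R = (>)"
    and AB: "\<And>a b. a \<in> A \<Longrightarrow> b \<in> B \<Longrightarrow> fst a < fst b \<and> R (snd a) (snd b)"
  shows "occ (A \<union> B) \<sigma> =
    (\<Sum>i\<le>length \<sigma>. if separates R i \<sigma> then occ A (take i \<sigma>) * occ B (drop i \<sigma>) else 0)"
proof -
  let ?I = "{i. i \<le> length \<sigma> \<and> separates R i \<sigma>}"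
  let ?P = "\<lambda>i. occs A (take i \<sigma>) \<times> occs B (drop i \<sigma>)"
  let ?F = "\<lambda>i. (\<lambda>(as, bs). as @ bs) ` ?P i"
  have disj: "A \<inter> B = {}" using AB by fastforce
  have len: "length as = i" if "as \<in> occs A (take i \<sigma>)" "i \<le> length \<sigma>" for as i
    using that by (auto simp: occs_def dest: order_isomorphicD(1))
  \<comment> \<open>The number of points in \<open>A\<close> recovers the cut, so different cuts
    have disjoint sets of occurrences.\<close>
  have cnt: "length (filter (\<lambda>q. q \<in> A) (as @ bs)) = i"
    if "as \<in> occs A (take i \<sigma>)" "bs \<in> occs B (drop i \<sigma>)" "i \<le> length \<sigma>" for as bs i
  proof -
    have "filter (\<lambda>q. q \<in> A) as = as" "filter (\<lambda>q. q \<in> A) bs = []"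
      using that disj by (auto simp: occs_def filter_id_conv filter_empty_conv)
    then show ?thesis using len that by simp
  qed
  have RAB: "R x y" if "set as \<subseteq> A" "set bs \<subseteq> B" "x \<in> set (map snd as)" "y \<in> set (map snd bs)" for as bs x y
  proof -
    obtain a b where "a \<in> set as" "x = snd a" "b \<in> set bs" "y = snd b" using \<open>x \<in> _\<close> \<open>y \<in> _\<close> by auto
    then show ?thesis using that AB by blast
  qed
  have eq: "occs (A \<union> B) \<sigma> = (\<Union>i\<in>?I. ?F i)"
  proof (intro equalityI subsetI)
    fix qs assume qs: "qs \<in> occs (A \<union> B) \<sigma>"
    define as where "as = takeWhile (\<lambda>q. q \<in> A) qs"
    define bs where "bs = dropWhile (\<lambda>q. q \<in> A) qs"
    define i where "i = length as"
    have split: "qs = as @ bs" by (simp add: as_def bs_def)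
    have asA: "set as \<subseteq> A" by (auto simp: as_def dest: set_takeWhileD)
    have srt: "sorted_wrt (<) (map fst as)" "sorted_wrt (<) (map fst bs)"
      using qs unfolding split by (auto simp: occs_def sorted_wrt_append)
    \<comment> \<open>The first point outside \<open>A\<close> lies in \<open>B\<close>, and a later
      point is further to the right, where no point of \<open>A\<close> can be.\<close>
    have bsB: "set bs \<subseteq> B"
    proof (cases bs)
      case (Cons b bs')
      have "b \<notin> A" using Cons by (simp add: bs_def dropWhile_eq_Cons_conv)
      then have b: "b \<in> B" using qs by (auto simp: split Cons occs_def)
      have "q \<in> B" if "q \<in> set bs'" for q
      proof -
        have "fst b < fst q" using srt(2) that by (auto simp: Cons)
        then have "q \<notin> A" using AB[OF _ b, of q] by auto
        then show ?thesis using qs that by (auto simp: split Cons occs_def)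
      qed
      then show ?thesis using b by (auto simp: Cons)
    qed simp
    have iso: "order_isomorphic (map snd as @ map snd bs) \<sigma>"
      using qs by (simp add: split occs_def)
    have L: "length as + length bs = length \<sigma>"
      using order_isomorphicD(1)[OF iso] by simp
    have "separates R i \<sigma> \<and> order_isomorphic (map snd as) (take i \<sigma>) \<and> order_isomorphic (map snd bs) (drop i \<sigma>)"
      using iso by (subst (asm) order_isomorphic_append_iff[OF R, of _ i]) (use RAB[OF asA bsB] L in \<open>simp_all add: i_def\<close>)
    then show "qs \<in> (\<Union>i\<in>?I. ?F i)"
      using asA bsB srt L by (auto simp: split occs_def i_def intro!: exI[of _ "length as"])
  next
    fix qs assume "qs \<in> (\<Union>i\<in>?I. ?F i)"
    then obtain i as bs where i: "i \<le> length \<sigma>" "separates R i \<sigma>" and as: "as \<in> occs A (take i \<sigma>)"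
      and bs: "bs \<in> occs B (drop i \<sigma>)" and qs: "qs = as @ bs" by auto
    have AB': "set as \<subseteq> A" "set bs \<subseteq> B" using as bs by (auto simp: occs_def)
    have lens: "length as = i" "length bs = length \<sigma> - i"
      using as bs i by (auto simp: occs_def dest: order_isomorphicD(1))
    have "order_isomorphic (map snd as @ map snd bs) \<sigma>"
      by (subst order_isomorphic_append_iff[OF R, of _ i])
        (use i as bs RAB[OF AB'] lens in \<open>simp_all add: occs_def\<close>)
    moreover have "fst a < fst b" if "a \<in> set as" "b \<in> set bs" for a b
      using that AB AB' by blast
    ultimately show "qs \<in> occs (A \<union> B) \<sigma>"
      using as bs AB' by (auto simp: qs occs_def sorted_wrt_append)
  qed
  have "occ (A \<union> B) \<sigma> = (\<Sum>i\<in>?I. card (?F i))"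
    unfolding occ_def eq
  proof (rule card_UN_disjoint)
    show "\<forall>i\<in>?I. \<forall>j\<in>?I. i \<noteq> j \<longrightarrow> ?F i \<inter> ?F j = {}"
    proof (intro ballI impI equals0I)
      fix i j qs assume ij: "i \<in> ?I" "j \<in> ?I" "i \<noteq> j" and "qs \<in> ?F i \<inter> ?F j"
      then have "length (filter (\<lambda>q. q \<in> A) qs) = i" "length (filter (\<lambda>q. q \<in> A) qs) = j"
        using cnt by (auto simp del: filter_append)
      with ij show False by simp
    qed
  qed (use fin in \<open>auto simp: finite_occs\<close>)
  also have "\<dots> = (\<Sum>i\<in>?I. occ A (take i \<sigma>) * occ B (drop i \<sigma>))"
  proof (rule sum.cong)
    fix i assume i: "i \<in> ?I"
    have "inj_on (\<lambda>(as, bs). as @ bs) (?P i)"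
      by (rule inj_onI) (use i len in \<open>auto simp: append_eq_append_conv\<close>)
    then show "card (?F i) = occ A (take i \<sigma>) * occ B (drop i \<sigma>)"
      by (simp add: card_image card_cartesian_product occ_def)
  qed simp
  also have "\<dots> = (\<Sum>i\<le>length \<sigma>. if separates R i \<sigma> then occ A (take i \<sigma>) * occ B (drop i \<sigma>) else 0)"
    by (rule sum.mono_neutral_cong_left) auto
  finally show ?thesis .
qed

lemma occ_image:
  assumes g: "strict_mono g" and h: "strict_mono h"
  shows "occ (map_prod g h ` Q) \<sigma> = occ Q \<sigma>"
proof -
  let ?f = "map_prod g h"
  have inj: "inj ?f" using g h by (simp add: strict_mono_imp_inj_on prod.inj_map)
  have "occs (?f ` Q) \<sigma> = map ?f ` occs Q \<sigma>"
  proof (intro equalityI subsetI)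
    fix qs assume qs: "qs \<in> occs (?f ` Q) \<sigma>"
    then have "qs \<in> lists (?f ` Q)" by (auto simp: occs_def)
    then obtain ps where ps: "qs = map ?f ps" "set ps \<subseteq> Q" by (auto simp: lists_image)
    have "order_isomorphic (map (\<lambda>p. h (snd p)) ps) \<sigma> \<longleftrightarrow> order_isomorphic (map snd ps) \<sigma>"
      by (rule order_isomorphic_map_cong) (use h in \<open>simp add: strict_mono_less\<close>)
    then have "ps \<in> occs Q \<sigma>" using qs ps g
      by (auto simp: occs_def sorted_wrt_map strict_mono_less comp_def)
    then show "qs \<in> map ?f ` occs Q \<sigma>" using ps by auto
  next
    fix qs assume "qs \<in> map ?f ` occs Q \<sigma>"
    then obtain ps where ps: "qs = map ?f ps" "ps \<in> occs Q \<sigma>" by auto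
    have "order_isomorphic (map (\<lambda>p. h (snd p)) ps) \<sigma> \<longleftrightarrow> order_isomorphic (map snd ps) \<sigma>"
      by (rule order_isomorphic_map_cong) (use h in \<open>simp add: strict_mono_less\<close>)
    then show "qs \<in> occs (?f ` Q) \<sigma>" using ps g
      by (auto simp: occs_def sorted_wrt_map strict_mono_less comp_def)
  qed
  then show ?thesis
    using inj by (simp add: occ_def card_image inj_on_subset[OF inj_mapI])
qed

text \<open>A crude strict bound for all coordinates; it serves as the shift in sums and later as
  the base of the digits in \<open>enc\<close>.\<close>

definition bd :: "(nat \<times> nat) set \<Rightarrow> nat" where
  "bd Q = Suc (\<Sum>p\<in>Q. fst p + snd p)"

lemma less_bd:
  assumes "finite Q" "p \<in> Q" shows "fst p < bd Q" "snd p < bd Q"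
  using member_le_sum[of p Q "\<lambda>p. fst p + snd p"] assms by (auto simp: bd_def)

definition dsum :: "(nat \<times> nat) set \<Rightarrow> (nat \<times> nat) set \<Rightarrow> (nat \<times> nat) set" where
  "dsum A B = A \<union> map_prod (\<lambda>x. x + bd A) (\<lambda>y. y + bd A) ` B"

definition ssum :: "(nat \<times> nat) set \<Rightarrow> (nat \<times> nat) set \<Rightarrow> (nat \<times> nat) set" where
  "ssum A B = map_prod (\<lambda>x. x) (\<lambda>y. y + bd B) ` A \<union> map_prod (\<lambda>x. x + bd A) (\<lambda>y. y) ` B"

lemma strict_mono_shift: "strict_mono (\<lambda>x::nat. x + c)" "strict_mono (\<lambda>x::nat. x)"
  by (auto simp: strict_mono_def)

lemma point_set_Un:
  assumes "point_set A" "point_set B" "\<And>a b. a \<in> A \<Longrightarrow> b \<in> B \<Longrightarrow> fst a \<noteq> fst b \<and> snd a \<noteq> snd b"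
  shows "point_set (A \<union> B)" "card (A \<union> B) = card A + card B"
proof -
  show "point_set (A \<union> B)"
    unfolding point_set_def
  proof (intro conjI inj_onI)
    fix p q assume pq: "p \<in> A \<union> B" "q \<in> A \<union> B"
    { assume "fst p = fst q"
      with pq assms(3)[of p q] assms(3)[of q p] have "p \<in> A \<and> q \<in> A \<or> p \<in> B \<and> q \<in> B" by auto
      with \<open>fst p = fst q\<close> show "p = q" using assms(1,2) by (metis inj_onD point_set_def) }
    { assume "snd p = snd q"
      with pq assms(3)[of p q] assms(3)[of q p] have "p \<in> A \<and> q \<in> A \<or> p \<in> B \<and> q \<in> B" by auto
      with \<open>snd p = snd q\<close> show "p = q" using assms(1,2) by (metis inj_onD point_set_def) }
  qed (use assms(1,2) in \<open>simp add: point_set_def\<close>)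
  have "A \<inter> B = {}" using assms(3) by blast
  then show "card (A \<union> B) = card A + card B"
    using assms(1,2) by (simp add: card_Un_disjoint point_set_def)
qed

lemma point_set_image:
  assumes "point_set Q" "strict_mono g" "strict_mono h"
  shows "point_set (map_prod g h ` Q)" "card (map_prod g h ` Q) = card Q"
proof -
  have "inj g" "inj h" using assms by (auto intro: strict_mono_imp_inj_on)
  then show "point_set (map_prod g h ` Q)"
    unfolding point_set_def
  proof (intro conjI inj_onI)
    fix p' q' assume "p' \<in> map_prod g h ` Q" "q' \<in> map_prod g h ` Q"
    then obtain p q where pq: "p \<in> Q" "q \<in> Q" "p' = map_prod g h p" "q' = map_prod g h q"
      by (elim imageE)
    { assume "fst p' = fst q'"
      then have "fst p = fst q" using pq \<open>inj g\<close> by (simp add: inj_eq)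
      then show "p' = q'" using pq assms(1) by (metis point_set_def inj_onD) }
    { assume "snd p' = snd q'"
      then have "snd p = snd q" using pq \<open>inj h\<close> by (simp add: inj_eq)
      then show "p' = q'" using pq assms(1) by (metis point_set_def inj_onD) }
  qed (use assms(1) in \<open>simp add: point_set_def\<close>)
  show "card (map_prod g h ` Q) = card Q"
    by (rule card_image) (use \<open>inj g\<close> \<open>inj h\<close> in \<open>simp add: inj_on_subset[OF prod.inj_map]\<close>)
qed

lemma dsum:
  assumes A: "point_set A" and B: "point_set B"
  shows "point_set (dsum A B)" "card (dsum A B) = card A + card B"
    "occ (dsum A B) \<sigma> = (\<Sum>i\<le>length \<sigma>. if separates (<) i \<sigma> then occ A (take i \<sigma>) * occ B (drop i \<sigma>) else 0)"
proof -
  let ?B = "map_prod (\<lambda>x. x + bd A) (\<lambda>y. y + bd A) ` B"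
  have fin: "finite A" "finite ?B" using A B by (auto simp: point_set_def)
  note B' = point_set_image[OF B strict_mono_shift(1) strict_mono_shift(1), of "bd A" "bd A"]
  have sep: "fst a < fst b \<and> snd a < snd b" if aA: "a \<in> A" and bB: "b \<in> ?B" for a b
  proof -
    obtain b' where "b = map_prod (\<lambda>x. x + bd A) (\<lambda>y. y + bd A) b'" using bB by (rule imageE)
    then show ?thesis using less_bd[OF fin(1) aA] by simp
  qed
  have "fst a \<noteq> fst b \<and> snd a \<noteq> snd b" if "a \<in> A" "b \<in> ?B" for a b
    using sep[OF that] by auto
  note U = point_set_Un[OF A B'(1) this]
  show "point_set (dsum A B)" "card (dsum A B) = card A + card B"
    using U B'(2) by (simp_all add: dsum_def)
  show "occ (dsum A B) \<sigma> = (\<Sum>i\<le>length \<sigma>. if separates (<) i \<sigma> then occ A (take i \<sigma>) * occ B (drop i \<sigma>) else 0)"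
    unfolding dsum_def by (subst occ_Un[OF fin _ sep]) (auto simp: occ_image strict_mono_shift cong: if_cong)
qed

lemma ssum:
  assumes A: "point_set A" and B: "point_set B"
  shows "point_set (ssum A B)" "card (ssum A B) = card A + card B"
    "occ (ssum A B) \<sigma> = (\<Sum>i\<le>length \<sigma>. if separates (>) i \<sigma> then occ A (take i \<sigma>) * occ B (drop i \<sigma>) else 0)"
proof -
  let ?A = "map_prod (\<lambda>x. x) (\<lambda>y. y + bd B) ` A"
  let ?B = "map_prod (\<lambda>x. x + bd A) (\<lambda>y. y) ` B"
  have fin: "finite A" "finite B" "finite ?A" "finite ?B" using A B by (auto simp: point_set_def)
  note A' = point_set_image[OF A strict_mono_shift(2) strict_mono_shift(1), of "bd B"]
  note B' = point_set_image[OF B strict_mono_shift(1) strict_mono_shift(2), of "bd A"]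
  have sep: "fst a < fst b \<and> snd a > snd b" if aA: "a \<in> ?A" and bB: "b \<in> ?B" for a b
  proof -
    obtain a' where "a = map_prod (\<lambda>x. x) (\<lambda>y. y + bd B) a'" "a' \<in> A" using aA by (rule imageE)
    moreover obtain b' where "b = map_prod (\<lambda>x. x + bd A) (\<lambda>y. y) b'" "b' \<in> B" using bB by (rule imageE)
    ultimately show ?thesis using less_bd[OF fin(1), of a'] less_bd[OF fin(2), of b'] by simp
  qed
  have "fst a \<noteq> fst b \<and> snd a \<noteq> snd b" if "a \<in> ?A" "b \<in> ?B" for a b
    using sep[OF that] by auto
  note U = point_set_Un[OF A'(1) B'(1) this]
  show "point_set (ssum A B)" "card (ssum A B) = card A + card B"
    using U A'(2) B'(2) by (simp_all add: ssum_def)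
  show "occ (ssum A B) \<sigma> = (\<Sum>i\<le>length \<sigma>. if separates (>) i \<sigma> then occ A (take i \<sigma>) * occ B (drop i \<sigma>) else 0)"
    unfolding ssum_def by (subst occ_Un[OF fin(3,4) _ sep]) (auto simp: occ_image strict_mono_shift cong: if_cong)
qed

definition incr :: "nat \<Rightarrow> (nat \<times> nat) set" where
  "incr m = (\<lambda>a. (a, a)) ` {..<m}"

text \<open>For \<open>a < m\<close> the truncated subtraction is exact, so the heights are
  distinct.\<close>

definition decr :: "nat \<Rightarrow> (nat \<times> nat) set" where
  "decr m = (\<lambda>a. (a, m - a)) ` {..<m}"

text \<open>All lists of a given length in a monotone set have the same order type, so either every
  subset of the right size is an occurrence or none is.\<close>

lemma incr:
  "point_set (incr m)" "card (incr m) = m"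
  "occ (incr m) \<sigma> = (if sorted_wrt (<) \<sigma> then m choose length \<sigma> else 0)"
proof -
  show ps: "point_set (incr m)" by (auto simp: point_set_def incr_def inj_on_def)
  show c: "card (incr m) = m" by (simp add: incr_def card_image inj_on_def)
  have iso: "order_isomorphic xs \<sigma> \<longleftrightarrow> sorted_wrt (<) \<sigma> \<and> length xs = length \<sigma>" if "sorted_wrt (<) xs" for xs
  proof
    assume "order_isomorphic xs \<sigma>"
    then show "sorted_wrt (<) \<sigma> \<and> length xs = length \<sigma>"
      using that unfolding sorted_wrt_iff_nth_less by (auto simp: order_isomorphic_def)
  next
    assume H: "sorted_wrt (<) \<sigma> \<and> length xs = length \<sigma>"
    then show "order_isomorphic xs \<sigma>"
    proof (unfold order_isomorphic_def, intro conjI allI impI)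
      fix a b assume "a < length xs" "b < length xs"
      then show "xs ! a < xs ! b \<longleftrightarrow> \<sigma> ! a < \<sigma> ! b"
        using H that unfolding sorted_wrt_iff_nth_less by (cases a b rule: linorder_cases) (auto dest: less_asym)
    qed simp
  qed
  have eq: "map snd qs = map fst qs" if "set qs \<subseteq> incr m" for qs
    using that by (auto simp: incr_def)
  have "order_isomorphic (map snd qs) \<sigma> \<longleftrightarrow> sorted_wrt (<) \<sigma> \<and> length qs = length \<sigma>"
    if "set qs \<subseteq> incr m" "sorted_wrt (<) (map fst qs)" for qs
    using iso[of "map snd qs"] that eq[OF that(1)] by (simp del: map_eq_conv)
  then have "occs (incr m) \<sigma> = {qs. set qs \<subseteq> incr m \<and> sorted_wrt (<) (map fst qs) \<and> sorted_wrt (<) \<sigma> \<and> length qs = length \<sigma>}"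
    unfolding occs_def by (simp cong: conj_cong)
  then have "occs (incr m) \<sigma> = (if sorted_wrt (<) \<sigma> then sorted_lists (incr m) (length \<sigma>) else {})"
    by (simp add: sorted_lists_def)
  then show "occ (incr m) \<sigma> = (if sorted_wrt (<) \<sigma> then m choose length \<sigma> else 0)"
    by (simp add: occ_def card_sorted_lists[OF ps] c)
qed

lemma decr:
  "point_set (decr m)" "card (decr m) = m"
  "occ (decr m) \<sigma> = (if sorted_wrt (>) \<sigma> then m choose length \<sigma> else 0)"
proof -
  show ps: "point_set (decr m)" by (auto simp: point_set_def decr_def inj_on_def)
  show c: "card (decr m) = m" by (simp add: decr_def card_image inj_on_def)
  have iso: "order_isomorphic xs \<sigma> \<longleftrightarrow> sorted_wrt (>) \<sigma> \<and> length xs = length \<sigma>" if "sorted_wrt (>) xs" for xs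
  proof
    assume "order_isomorphic xs \<sigma>"
    then show "sorted_wrt (>) \<sigma> \<and> length xs = length \<sigma>"
      using that unfolding sorted_wrt_iff_nth_less by (auto simp: order_isomorphic_def)
  next
    assume H: "sorted_wrt (>) \<sigma> \<and> length xs = length \<sigma>"
    then show "order_isomorphic xs \<sigma>"
    proof (unfold order_isomorphic_def, intro conjI allI impI)
      fix a b assume "a < length xs" "b < length xs"
      then show "xs ! a < xs ! b \<longleftrightarrow> \<sigma> ! a < \<sigma> ! b"
        using H that unfolding sorted_wrt_iff_nth_less by (cases a b rule: linorder_cases) (auto dest: less_asym)
    qed simp
  qed
  have srt: "sorted_wrt (>) (map snd qs)" if "set qs \<subseteq> decr m" "sorted_wrt (<) (map fst qs)" for qs
  proof -
    have "snd q < snd p" if "p \<in> decr m" "q \<in> decr m" "fst p < fst q" for p q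
      using that by (auto simp: decr_def)
    with that(1) have "sorted_wrt (\<lambda>p q. snd q < snd p) qs"
      by (intro sorted_wrt_mono_rel[OF _ that(2)[unfolded sorted_wrt_map]]) blast
    then show ?thesis by (simp add: sorted_wrt_map)
  qed
  have "order_isomorphic (map snd qs) \<sigma> \<longleftrightarrow> sorted_wrt (>) \<sigma> \<and> length qs = length \<sigma>"
    if "set qs \<subseteq> decr m" "sorted_wrt (<) (map fst qs)" for qs
    using iso[of "map snd qs"] srt[OF that] by simp
  then have "occs (decr m) \<sigma> = {qs. set qs \<subseteq> decr m \<and> sorted_wrt (<) (map fst qs) \<and> sorted_wrt (>) \<sigma> \<and> length qs = length \<sigma>}"
    unfolding occs_def by (simp cong: conj_cong)
  then have "occs (decr m) \<sigma> = (if sorted_wrt (>) \<sigma> then sorted_lists (decr m) (length \<sigma>) else {})"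
    by (simp add: sorted_lists_def)
  then show "occ (decr m) \<sigma> = (if sorted_wrt (>) \<sigma> then m choose length \<sigma> else 0)"
    by (simp add: occ_def card_sorted_lists[OF ps] c)
qed

section \<open>Grids of copies of a point set\<close>

definition lexless :: "nat \<times> nat \<Rightarrow> nat \<times> nat \<Rightarrow> bool" where
  "lexless p q \<longleftrightarrow> fst p < fst q \<or> fst p = fst q \<and> snd p < snd q"

text \<open>Unlike in \<open>is_permutation\<close>, the values start at 0, so that entries can
  serve as list indices.\<close>

abbreviation perms :: "nat \<Rightarrow> nat list set" where
  "perms k \<equiv> permutations_of_set {..<k}"

lemma permsD: "\<alpha> \<in> perms k \<Longrightarrow> length \<alpha> = k" "\<alpha> \<in> perms k \<Longrightarrow> distinct \<alpha>" "\<alpha> \<in> perms k \<Longrightarrow> set \<alpha> = {..<k}"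
  using distinct_card[of \<alpha>] by (auto simp: permutations_of_set_def)

lemma order_type_exists:
  assumes "distinct xs"
  shows "\<exists>\<pi>\<in>perms (length xs). order_isomorphic xs \<pi>"
proof -
  define rk where "rk x = card {y \<in> set xs. y < x}" for x :: nat
  have rk: "rk x < rk y" if "x \<in> set xs" "x < y" for x y
  proof -
    have "{z \<in> set xs. z < x} \<subset> {z \<in> set xs. z < y}" using that by fastforce
    then show ?thesis unfolding rk_def by (simp add: psubset_card_mono)
  qed
  have rk_iff: "rk x < rk y \<longleftrightarrow> x < y" if "x \<in> set xs" "y \<in> set xs" for x y
    using rk[OF that(1), of y] rk[OF that(2), of x] by (cases x y rule: linorder_cases) auto
  have inj: "inj_on rk (set xs)"
    by (rule inj_onI) (metis rk linorder_less_linear less_irrefl)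
  have "rk ` set xs \<subseteq> {..<length xs}"
  proof
    fix y assume "y \<in> rk ` set xs"
    then obtain x where x: "x \<in> set xs" "y = rk x" by auto
    have "{z \<in> set xs. z < x} \<subset> set xs" using x by auto
    then have "rk x < card (set xs)" unfolding rk_def by (simp add: psubset_card_mono)
    then show "y \<in> {..<length xs}" using x card_length[of xs] by simp
  qed
  then have "rk ` set xs = {..<length xs}"
    by (rule card_subset_eq[rotated]) (auto simp: card_image inj distinct_card[OF assms])
  then have "map rk xs \<in> perms (length xs)"
    using inj assms by (simp add: permutations_of_set_def distinct_map)
  moreover have "order_isomorphic xs (map rk xs)"
    using order_isomorphic_map_cong[of xs "\<lambda>x. x" rk "map rk xs"] rk_iff
    by (simp add: order_isomorphic_def)
  ultimately show ?thesis by blast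
qed

text \<open>An entry of such a permutation equals the number of smaller entries, which the
  comparisons determine.\<close>

lemma perms_order_isomorphic_unique:
  assumes "\<pi> \<in> perms k" "\<pi>' \<in> perms k" "order_isomorphic \<pi> \<pi>'"
  shows "\<pi> = \<pi>'"
proof (rule nth_equalityI)
  show "length \<pi> = length \<pi>'" using assms by (simp add: permsD)
  fix i assume i: "i < length \<pi>"
  have rank: "\<tau> ! i = card {j. j < k \<and> \<tau> ! j < \<tau> ! i}" if "\<tau> \<in> perms k" "i < k" for \<tau>
  proof -
    have \<tau>: "length \<tau> = k" "distinct \<tau>" "set \<tau> = {..<k}" using permsD[OF that(1)] by auto
    have "bij_betw ((!) \<tau>) {j. j < k \<and> \<tau> ! j < \<tau> ! i} {..<\<tau> ! i}"
    proof (rule bij_betw_imageI)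
      show "inj_on ((!) \<tau>) {j. j < k \<and> \<tau> ! j < \<tau> ! i}"
        using \<tau> by (auto intro!: inj_on_nth)
      have "y \<in> (!) \<tau> ` {j. j < k \<and> \<tau> ! j < \<tau> ! i}" if "y < \<tau> ! i" for y
      proof -
        have "\<tau> ! i < k" using \<tau> \<open>i < k\<close> nth_mem[of i \<tau>] by auto
        then have "y \<in> set \<tau>" using \<tau> that by simp
        then obtain j where "j < k" "\<tau> ! j = y" using \<tau>(1) by (auto simp only: in_set_conv_nth)
        then show ?thesis using that by auto
      qed
      then show "(!) \<tau> ` {j. j < k \<and> \<tau> ! j < \<tau> ! i} = {..<\<tau> ! i}" by auto
    qed
    from bij_betw_same_card[OF this] show ?thesis by simp
  qed
  have "{j. j < k \<and> \<pi> ! j < \<pi> ! i} = {j. j < k \<and> \<pi>' ! j < \<pi>' ! i}"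
    using order_isomorphicD[OF assms(3)] i assms by (auto simp: permsD)
  then show "\<pi> ! i = \<pi>' ! i"
    using rank[OF assms(1)] rank[OF assms(2)] i permsD(1)[OF assms(1)] by metis
qed

text \<open>The lists are partitioned by their order types, and each class contributes its size
  times the common value of \<open>f\<close>.\<close>

lemma sum_sorted_lists_by_pattern:
  assumes "point_set V" and f: "\<And>\<rho> \<rho>'. order_isomorphic \<rho> \<rho>' \<Longrightarrow> f \<rho> = (f \<rho>' :: nat)"
  shows "(\<Sum>qs\<in>sorted_lists V k. f (map snd qs)) = (\<Sum>\<pi>\<in>perms k. occ V \<pi> * f \<pi>)"
proof -
  have fin: "finite V" using assms(1) by (simp add: point_set_def)
  have "sorted_lists V k = (\<Union>\<pi>\<in>perms k. occs V \<pi>)"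
  proof (intro equalityI subsetI)
    fix qs assume qs: "qs \<in> sorted_lists V k"
    have "distinct qs"
      using qs distinct_map[of fst qs] strict_sorted_iff[of "map fst qs"] by (auto simp: sorted_lists_def)
    moreover have "inj_on snd (set qs)"
      using qs assms(1) by (auto simp: sorted_lists_def point_set_def intro: inj_on_subset)
    ultimately have "distinct (map snd qs)" by (simp add: distinct_map)
    from order_type_exists[OF this] obtain \<pi> where "\<pi> \<in> perms k" "order_isomorphic (map snd qs) \<pi>"
      using qs by (auto simp: sorted_lists_def)
    then show "qs \<in> (\<Union>\<pi>\<in>perms k. occs V \<pi>)"
      using qs by (auto simp: occs_def sorted_lists_def)
  next
    fix qs assume "qs \<in> (\<Union>\<pi>\<in>perms k. occs V \<pi>)"
    then obtain \<pi> where "\<pi> \<in> perms k" "qs \<in> occs V \<pi>" by blast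
    then show "qs \<in> sorted_lists V k"
      using occs_subset_sorted_lists[of V \<pi>] permsD(1)[of \<pi> k] by auto
  qed
  moreover have "(\<Sum>qs\<in>(\<Union>\<pi>\<in>perms k. occs V \<pi>). f (map snd qs)) = (\<Sum>\<pi>\<in>perms k. \<Sum>qs\<in>occs V \<pi>. f (map snd qs))"
  proof (rule sum.UNION_disjoint)
    show "\<forall>\<pi>\<in>perms k. \<forall>\<pi>'\<in>perms k. \<pi> \<noteq> \<pi>' \<longrightarrow> occs V \<pi> \<inter> occs V \<pi>' = {}"
    proof (intro ballI impI equals0I)
      fix \<pi> \<pi>' qs assume p: "\<pi> \<in> perms k" "\<pi>' \<in> perms k" "\<pi> \<noteq> \<pi>'" and "qs \<in> occs V \<pi> \<inter> occs V \<pi>'"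
      then have "order_isomorphic \<pi> \<pi>'"
        using order_isomorphic_trans[OF order_isomorphic_sym[THEN iffD1], of "map snd qs" \<pi> \<pi>']
        by (simp add: occs_def)
      then show False using perms_order_isomorphic_unique p by blast
    qed
  qed (auto simp: finite_occs fin)
  moreover have "(\<Sum>qs\<in>occs V \<pi>. f (map snd qs)) = occ V \<pi> * f \<pi>" for \<pi>
  proof -
    have "(\<Sum>qs\<in>occs V \<pi>. f (map snd qs)) = (\<Sum>qs\<in>occs V \<pi>. f \<pi>)"
      by (rule sum.cong) (auto simp: occs_def intro: f)
    then show ?thesis by (simp add: occ_def)
  qed
  ultimately show ?thesis by simp
qed

lemma nth_image_lessThan: "length xs = k \<Longrightarrow> (!) xs ` {..<k} = set xs"
  by (auto simp: set_conv_nth)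

text \<open>A list of distinct points amounts to its set of points, sorted as \<open>qs\<close>, and
  the order \<open>\<alpha>\<close> in which the list visits them.\<close>

lemma bij_betw_distinct_lists:
  assumes V: "point_set V"
  shows "bij_betw (\<lambda>(qs, \<alpha>). map ((!) qs) \<alpha>) (sorted_lists V k \<times> perms k)
    {vs. length vs = k \<and> distinct vs \<and> set vs \<subseteq> V}"
proof (rule bij_betw_imageI)
  have dist: "distinct qs" if "qs \<in> sorted_lists V k" for qs
    using that distinct_map[of fst qs] strict_sorted_iff[of "map fst qs"] by (auto simp: sorted_lists_def)
  have set: "set (map ((!) qs) \<alpha>) = set qs" if "qs \<in> sorted_lists V k" "\<alpha> \<in> perms k" for qs \<alpha>
    using that by (simp add: sorted_lists_def permsD nth_image_lessThan)
  show "inj_on (\<lambda>(qs, \<alpha>). map ((!) qs) \<alpha>) (sorted_lists V k \<times> perms k)"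
  proof (rule inj_onI, clarify)
    fix qs \<alpha> qs' \<alpha>'
    assume q: "qs \<in> sorted_lists V k" "qs' \<in> sorted_lists V k" and a: "\<alpha> \<in> perms k" "\<alpha>' \<in> perms k"
      and eq: "map ((!) qs) \<alpha> = map ((!) qs') \<alpha>'"
    have "set qs' = set qs" using set[OF q(1) a(1)] set[OF q(2) a(2)] eq by simp
    then have qq: "qs = qs'" by (intro sorted_lists_eqI[OF V]) (use q in \<open>auto simp: sorted_lists_def\<close>)
    have "inj_on ((!) qs) (set \<alpha> \<union> set \<alpha>')"
      using dist[OF q(1)] q(1) a by (auto simp: sorted_lists_def permsD intro!: inj_on_nth)
    then have "\<alpha> = \<alpha>'" using eq qq inj_on_map_eq_map by blast
    with qq show "qs = qs' \<and> \<alpha> = \<alpha>'" by simp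
  qed
  show "(\<lambda>(qs, \<alpha>). map ((!) qs) \<alpha>) ` (sorted_lists V k \<times> perms k) = {vs. length vs = k \<and> distinct vs \<and> set vs \<subseteq> V}"
  proof (intro equalityI subsetI)
    fix vs assume "vs \<in> (\<lambda>(qs, \<alpha>). map ((!) qs) \<alpha>) ` (sorted_lists V k \<times> perms k)"
    then obtain qs \<alpha> where q: "qs \<in> sorted_lists V k" "\<alpha> \<in> perms k" "vs = map ((!) qs) \<alpha>" by auto
    have "inj_on ((!) qs) (set \<alpha>)"
      using dist[OF q(1)] q by (auto simp: sorted_lists_def permsD intro!: inj_on_nth)
    moreover have "set vs \<subseteq> V" using set[OF q(1,2)] q(1,3) by (simp add: sorted_lists_def)
    ultimately show "vs \<in> {vs. length vs = k \<and> distinct vs \<and> set vs \<subseteq> V}"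
      using q by (simp add: permsD distinct_map)
  next
    fix vs assume vs: "vs \<in> {vs. length vs = k \<and> distinct vs \<and> set vs \<subseteq> V}"
    then have ps: "point_set (set vs)"
      using V by (auto simp: point_set_def intro: inj_on_subset)
    obtain qs where qs: "set qs = set vs" "distinct qs" "sorted_wrt (<) (map fst qs)" "length qs = card (set vs)"
      using sorted_list_of_points[OF ps] .
    have k: "length qs = k" using qs vs by (simp add: distinct_card)
    let ?g = "inv_into {..<k} ((!) qs)"
    have inj: "inj_on ((!) qs) {..<k}" using qs(2) k by (auto intro!: inj_on_nth)
    have im: "(!) qs ` {..<k} = set vs"
      using k qs(1) by (simp add: nth_image_lessThan)
    have bij: "bij_betw ?g (set vs) {..<k}"
      using bij_betw_inv_into[of "(!) qs" "{..<k}" "set vs"] inj im by (simp add: bij_betw_def)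
    have "map ?g vs \<in> perms k"
      using bij vs by (auto simp: permutations_of_set_def bij_betw_def distinct_map)
    moreover have "map ((!) qs) (map ?g vs) = vs"
      unfolding map_map by (rule map_idI) (use im f_inv_into_f[of _ "(!) qs" "{..<k}"] in auto)
    moreover have "qs \<in> sorted_lists V k"
      using qs k vs by (auto simp: sorted_lists_def)
    ultimately show "vs \<in> (\<lambda>(qs, \<alpha>). map ((!) qs) \<alpha>) ` (sorted_lists V k \<times> perms k)"
      by (intro image_eqI[of _ _ "(qs, map ?g vs)"]) simp_all
  qed
qed

text \<open>
  A list of points of the grid is given by its cells \<open>ws\<close> and by its points in the template, whose order types in
  the two coordinates are \<open>\<alpha>\<close> and \<open>\<rho> \<circ> \<alpha>\<close>; the condition says that it induces the pattern \<open>\<sigma>\<close>.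
\<close>

definition cell_cond :: "('w \<Rightarrow> nat) \<Rightarrow> ('w \<Rightarrow> nat) \<Rightarrow> nat list \<Rightarrow> nat list \<Rightarrow> nat list \<Rightarrow> 'w list \<Rightarrow> bool" where
  "cell_cond c r \<sigma> \<rho> \<alpha> ws \<longleftrightarrow>
    (\<forall>j<length \<sigma>. \<forall>i<j. lexless (c (ws ! i), \<alpha> ! i) (c (ws ! j), \<alpha> ! j)) \<and>
    (\<forall>i<length \<sigma>. \<forall>j<length \<sigma>.
      lexless (r (ws ! i), \<rho> ! (\<alpha> ! i)) (r (ws ! j), \<rho> ! (\<alpha> ! j)) \<longleftrightarrow> \<sigma> ! i < \<sigma> ! j)"

definition cell_lists :: "'w set \<Rightarrow> nat \<Rightarrow> 'w list set" where
  "cell_lists W k = {ws. set ws \<subseteq> W \<and> length ws = k}"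

text \<open>The coefficient with which the count of \<open>\<rho>\<close> in the template enters the
  count of \<open>\<sigma>\<close> in the grid; \<open>\<alpha>\<close> runs over the orders in
  which an occurrence may visit the template points.\<close>

definition cell_count :: "('w \<Rightarrow> nat) \<Rightarrow> ('w \<Rightarrow> nat) \<Rightarrow> 'w set \<Rightarrow> nat list \<Rightarrow> nat list \<Rightarrow> nat" where
  "cell_count c r W \<sigma> \<rho> =
    (\<Sum>\<alpha>\<in>perms (length \<sigma>). card {ws \<in> cell_lists W (length \<sigma>). cell_cond c r \<sigma> \<rho> \<alpha> ws})"

text \<open>
  The summand \<open>idx\<close> only separates points with the same position in the template and in the same column or row;
  such points do not contribute to the limit.
\<close>

definition enc :: "('w \<Rightarrow> nat) \<Rightarrow> ('w \<Rightarrow> nat) \<Rightarrow> ('w \<Rightarrow> nat) \<Rightarrow> nat \<Rightarrow> nat \<Rightarrow> 'w \<times> nat \<times> nat \<Rightarrow> nat \<times> nat" where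
  "enc c r idx L B p =
    ((c (fst p) * B + fst (snd p)) * L + idx (fst p), (r (fst p) * B + snd (snd p)) * L + idx (fst p))"

definition tile :: "('w \<Rightarrow> nat) \<Rightarrow> ('w \<Rightarrow> nat) \<Rightarrow> ('w \<Rightarrow> nat) \<Rightarrow> nat \<Rightarrow> 'w set \<Rightarrow> (nat \<times> nat) set \<Rightarrow> (nat \<times> nat) set" where
  "tile c r idx L W V = enc c r idx L (bd V) ` (W \<times> V)"

lemma cell_cond_cong:
  assumes "order_isomorphic \<rho> \<rho>'" "length \<rho> = length \<sigma>" "\<alpha> \<in> perms (length \<sigma>)"
  shows "cell_cond c r \<sigma> \<rho> \<alpha> ws \<longleftrightarrow> cell_cond c r \<sigma> \<rho>' \<alpha> ws"
proof -
  have "\<rho> ! (\<alpha> ! i) < \<rho> ! (\<alpha> ! j) \<longleftrightarrow> \<rho>' ! (\<alpha> ! i) < \<rho>' ! (\<alpha> ! j)" if "i < length \<sigma>" "j < length \<sigma>" for i j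
  proof -
    have "\<alpha> ! i \<in> set \<alpha>" "\<alpha> ! j \<in> set \<alpha>" using that permsD(1)[OF assms(3)] by auto
    then show ?thesis using assms(1,2) permsD(3)[OF assms(3)] by (auto simp: order_isomorphic_def)
  qed
  then show ?thesis by (simp add: cell_cond_def lexless_def cong: conj_cong)
qed

lemma digits_less_iff: "i < L \<Longrightarrow> j < L \<Longrightarrow> a * L + i < b * L + j \<longleftrightarrow> a < b \<or> a = b \<and> i < (j::nat)"
proof (cases a b rule: linorder_cases)
  assume "a < b" "i < L" "j < L"
  then have "a * L + i < Suc a * L" by simp
  also have "\<dots> \<le> b * L" using \<open>a < b\<close> by (intro mult_le_mono1) simp
  finally show ?thesis using \<open>a < b\<close> by simp
next
  assume "a > b" "i < L" "j < L"
  then have "b * L + j < Suc b * L" by simp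
  also have "\<dots> \<le> a * L" using \<open>a > b\<close> by (intro mult_le_mono1) simp
  finally show ?thesis using \<open>a > b\<close> by simp
qed simp

lemma digits_eq_iff: "i < L \<Longrightarrow> j < L \<Longrightarrow> a * L + i = b * L + j \<longleftrightarrow> a = b \<and> i = (j::nat)"
  using digits_less_iff[of i L j a b] digits_less_iff[of j L i b a] by (metis less_irrefl linorder_less_linear)

section \<open>Occurrences in a grid of copies\<close>

context
  fixes c r idx :: "'w \<Rightarrow> nat" and L :: nat and W :: "'w set" and V :: "(nat \<times> nat) set"
  assumes W: "finite W" and idx: "inj_on idx W" "\<And>w. w \<in> W \<Longrightarrow> idx w < L" and V: "point_set V"
begin

lemma finV: "finite V"
  using V by (simp add: point_set_def)

text \<open>Distinct template points differ in both coordinates, so the lowest digit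
  \<open>idx\<close> never decides a comparison.\<close>

lemma enc_less:
  assumes "w \<in> W" "w' \<in> W" "v \<in> V" "v' \<in> V" "v \<noteq> v'"
  shows "fst (enc c r idx L (bd V) (w, v)) < fst (enc c r idx L (bd V) (w', v')) \<longleftrightarrow> lexless (c w, fst v) (c w', fst v')"
    "snd (enc c r idx L (bd V) (w, v)) < snd (enc c r idx L (bd V) (w', v')) \<longleftrightarrow> lexless (r w, snd v) (r w', snd v')"
proof -
  have ne: "fst v \<noteq> fst v'" "snd v \<noteq> snd v'" using V assms by (auto simp: point_set_def dest: inj_onD)
  have i: "idx w < L" "idx w' < L" using idx assms by auto
  have b: "fst v < bd V" "fst v' < bd V" "snd v < bd V" "snd v' < bd V" using less_bd[OF finV] assms by auto
  show "fst (enc c r idx L (bd V) (w, v)) < fst (enc c r idx L (bd V) (w', v')) \<longleftrightarrow> lexless (c w, fst v) (c w', fst v')"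
    using ne i b by (auto simp: enc_def lexless_def digits_less_iff digits_eq_iff)
  show "snd (enc c r idx L (bd V) (w, v)) < snd (enc c r idx L (bd V) (w', v')) \<longleftrightarrow> lexless (r w, snd v) (r w', snd v')"
    using ne i b by (auto simp: enc_def lexless_def digits_less_iff digits_eq_iff)
qed

text \<open>Equal coordinates have equal lowest digits, hence the cells agree, and they have equal
  template digits, hence the template points agree.\<close>

lemma enc_inj:
  assumes "p \<in> W \<times> V" "q \<in> W \<times> V"
    "fst (enc c r idx L (bd V) p) = fst (enc c r idx L (bd V) q) \<or> snd (enc c r idx L (bd V) p) = snd (enc c r idx L (bd V) q)"
  shows "p = q"
proof -
  obtain w v w' v' where p: "p = (w, v)" "q = (w', v')" "w \<in> W" "v \<in> V" "w' \<in> W" "v' \<in> V"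
    using assms(1,2) by (metis SigmaE)
  have i: "idx w < L" "idx w' < L" using idx p by auto
  have b: "fst v < bd V" "fst v' < bd V" "snd v < bd V" "snd v' < bd V" using less_bd[OF finV] p by auto
  have "idx w = idx w' \<and> (fst v = fst v' \<or> snd v = snd v')"
    using assms(3) i b by (auto simp: p enc_def digits_eq_iff)
  then show ?thesis using p idx(1) V by (auto simp: point_set_def dest: inj_onD)
qed

lemma tile: "point_set (tile c r idx L W V)" "card (tile c r idx L W V) = card W * card V"
proof -
  show "point_set (tile c r idx L W V)"
    unfolding point_set_def tile_def
  proof (intro conjI inj_onI)
    fix p' q' assume "p' \<in> enc c r idx L (bd V) ` (W \<times> V)" "q' \<in> enc c r idx L (bd V) ` (W \<times> V)"
    then obtain p q where pq: "p \<in> W \<times> V" "q \<in> W \<times> V"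
      "p' = enc c r idx L (bd V) p" "q' = enc c r idx L (bd V) q" by (elim imageE)
    { assume "fst p' = fst q'"
      then show "p' = q'" using enc_inj[of p q] pq by simp }
    { assume "snd p' = snd q'"
      then show "p' = q'" using enc_inj[of p q] pq by simp }
  qed (use W finV in simp)
  have "inj_on (enc c r idx L (bd V)) (W \<times> V)" using enc_inj by (intro inj_onI) auto
  then show "card (tile c r idx L W V) = card W * card V"
    by (simp add: tile_def card_image card_cartesian_product)
qed

text \<open>Occurrences with distinct template points are grouped by the order type of these points
  and give the main sum. The others, counted by \<open>e\<close>, are bounded by the number of cell
  lists times the number of template lists with a repetition. The bound is additive to avoid
  subtraction in \<open>nat\<close>.\<close>

lemma occ_tile:
  fixes \<sigma> :: "nat list"
  defines "k \<equiv> length \<sigma>"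
  shows "\<exists>e. occ (tile c r idx L W V) \<sigma> = (\<Sum>\<pi>\<in>perms k. occ V \<pi> * cell_count c r W \<sigma> \<pi>) + e \<and>
    e + card W ^ k * (fact k * (card V choose k)) \<le> card W ^ k * card V ^ k"
proof -
  let ?e = "enc c r idx L (bd V)"
  define good where "good ws vs \<longleftrightarrow> sorted_wrt (<) (map fst (map ?e (zip ws vs))) \<and>
      order_isomorphic (map snd (map ?e (zip ws vs))) \<sigma>" for ws vs
  let ?D = "{vs. length vs = k \<and> distinct vs \<and> set vs \<subseteq> V}"
  let ?N = "{vs. set vs \<subseteq> V \<and> length vs = k} - ?D"
  let ?S = "\<lambda>U. SIGMA vs:U. {ws \<in> cell_lists W k. good ws vs}"
  have finD: "finite ?D" "finite ?N" "finite (cell_lists W k)"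
    using finite_lists_length_eq[OF finV, of k] finite_lists_length_eq[OF W, of k]
    by (auto simp: cell_lists_def intro: finite_subset[rotated])
  have finS: "finite (?S ?D)" "finite (?S ?N)" using finD by auto
  have enc_inj': "inj_on ?e (W \<times> V)" using enc_inj by (intro inj_onI) auto
  have "bij_betw (\<lambda>(vs, ws). map ?e (zip ws vs)) (?S ?D \<union> ?S ?N) (occs (tile c r idx L W V) \<sigma>)"
  proof (rule bij_betw_imageI)
    show "inj_on (\<lambda>(vs, ws). map ?e (zip ws vs)) (?S ?D \<union> ?S ?N)"
    proof (rule inj_onI, clarify)
      fix vs ws vs' ws'
      assume a: "(vs, ws) \<in> ?S ?D \<union> ?S ?N" "(vs', ws') \<in> ?S ?D \<union> ?S ?N"
        and eq: "map ?e (zip ws vs) = map ?e (zip ws' vs')"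
      have l: "length vs = k" "length ws = k" "length vs' = k" "length ws' = k"
        "set vs \<subseteq> V" "set ws \<subseteq> W" "set vs' \<subseteq> V" "set ws' \<subseteq> W"
        using a by (auto simp: cell_lists_def)
      have "set (zip ws vs) \<union> set (zip ws' vs') \<subseteq> W \<times> V"
        using l by (auto dest: set_zip_leftD set_zip_rightD)
      then have "zip ws vs = zip ws' vs'"
        using eq inj_on_map_eq_map[OF inj_on_subset[OF enc_inj']] by blast
      then show "vs = vs' \<and> ws = ws'" using l by (metis map_fst_zip map_snd_zip)
    qed
    show "(\<lambda>(vs, ws). map ?e (zip ws vs)) ` (?S ?D \<union> ?S ?N) = occs (tile c r idx L W V) \<sigma>"
    proof (intro equalityI subsetI)
      fix qs assume "qs \<in> (\<lambda>(vs, ws). map ?e (zip ws vs)) ` (?S ?D \<union> ?S ?N)"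
      then obtain vs ws where q: "qs = map ?e (zip ws vs)" "set vs \<subseteq> V" "set ws \<subseteq> W" "good ws vs"
        by (auto simp: cell_lists_def)
      have "set (zip ws vs) \<subseteq> W \<times> V" using q by (auto dest: set_zip_leftD set_zip_rightD)
      then show "qs \<in> occs (tile c r idx L W V) \<sigma>"
        using q(1,4) by (auto simp: occs_def tile_def good_def)
    next
      fix qs assume qs: "qs \<in> occs (tile c r idx L W V) \<sigma>"
      then have "qs \<in> lists (?e ` (W \<times> V))" by (auto simp: occs_def tile_def)
      then obtain ps where ps: "qs = map ?e ps" "set ps \<subseteq> W \<times> V" by (auto simp: lists_image)
      have len: "length ps = k" using qs ps by (auto simp: occs_def k_def dest: order_isomorphicD(1))
      have z: "zip (map fst ps) (map snd ps) = ps" by (simp add: zip_map_fst_snd)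
      have "(map snd ps, map fst ps) \<in> ?S ?D \<union> ?S ?N"
        using qs ps len z by (auto simp: cell_lists_def good_def occs_def)
      then show "qs \<in> (\<lambda>(vs, ws). map ?e (zip ws vs)) ` (?S ?D \<union> ?S ?N)"
        using ps z by (intro image_eqI[of _ _ "(map snd ps, map fst ps)"]) simp_all
    qed
  qed
  then have "occ (tile c r idx L W V) \<sigma> = card (?S ?D \<union> ?S ?N)"
    by (simp add: occ_def bij_betw_same_card)
  also have "\<dots> = card (?S ?D) + card (?S ?N)"
    using finS by (intro card_Un_disjoint) auto
  finally have total: "occ (tile c r idx L W V) \<sigma> = card (?S ?D) + card (?S ?N)" .
  \<comment> \<open>The first coordinates of \<open>qs\<close> increase, so the indices in
    \<open>\<alpha>\<close> can replace them in comparisons; of the second coordinates only their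
    order will matter.\<close>
  have good_iff: "good ws (map ((!) qs) \<alpha>) \<longleftrightarrow> cell_cond c r \<sigma> (map snd qs) \<alpha> ws"
    if qs: "qs \<in> sorted_lists V k" and \<alpha>: "\<alpha> \<in> perms k" and ws: "ws \<in> cell_lists W k" for qs \<alpha> ws
  proof -
    have lens: "length qs = k" "length \<alpha> = k" "length ws = k"
      using qs \<alpha> ws by (auto simp: sorted_lists_def permsD cell_lists_def)
    have ai: "\<alpha> ! i < k" if "i < k" for i
      using permsD(3)[OF \<alpha>] that lens nth_mem[of i \<alpha>] by auto
    have dq: "distinct qs" using qs distinct_map[of fst qs] strict_sorted_iff[of "map fst qs"] by (auto simp: sorted_lists_def)
    have mem: "ws ! i \<in> W" "qs ! (\<alpha> ! i) \<in> V" if "i < k" for i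
      using that ws qs lens ai[OF that] by (auto simp: cell_lists_def sorted_lists_def)
    have ne: "qs ! (\<alpha> ! i) \<noteq> qs ! (\<alpha> ! j)" if "i < k" "j < k" "i \<noteq> j" for i j
      using that dq ai permsD(2)[OF \<alpha>] lens by (simp add: nth_eq_iff_index_eq)
    have fq: "fst (qs ! a) < fst (qs ! b) \<longleftrightarrow> a < b" if "a < k" "b < k" for a b
    proof -
      have "sorted_wrt (<) (map fst qs)" using qs by (simp add: sorted_lists_def)
      then have "fst (qs ! a) < fst (qs ! b)" if "a < b" "b < k" for a b
        using that lens unfolding sorted_wrt_iff_nth_less by auto
      then show ?thesis using that by (cases a b rule: linorder_cases) (auto dest: less_asym)
    qed
    have 1: "sorted_wrt (<) (map fst (map ?e (zip ws (map ((!) qs) \<alpha>)))) \<longleftrightarrow>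
        (\<forall>j<k. \<forall>i<j. lexless (c (ws ! i), \<alpha> ! i) (c (ws ! j), \<alpha> ! j))"
    proof -
      have "fst (?e (ws ! i, qs ! (\<alpha> ! i))) < fst (?e (ws ! j, qs ! (\<alpha> ! j))) \<longleftrightarrow>
          lexless (c (ws ! i), \<alpha> ! i) (c (ws ! j), \<alpha> ! j)" if "i < j" "j < k" for i j
        using enc_less(1)[of "ws ! i" "ws ! j" "qs ! (\<alpha> ! i)" "qs ! (\<alpha> ! j)"] mem ne[of i j] fq[of "\<alpha> ! i" "\<alpha> ! j"] ai that
        by (auto simp: lexless_def)
      then show ?thesis using lens unfolding sorted_wrt_iff_nth_less by auto
    qed
    have 2: "order_isomorphic (map snd (map ?e (zip ws (map ((!) qs) \<alpha>)))) \<sigma> \<longleftrightarrow>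
        (\<forall>i<k. \<forall>j<k. lexless (r (ws ! i), map snd qs ! (\<alpha> ! i)) (r (ws ! j), map snd qs ! (\<alpha> ! j)) \<longleftrightarrow> \<sigma> ! i < \<sigma> ! j)"
    proof -
      have "snd (?e (ws ! i, qs ! (\<alpha> ! i))) < snd (?e (ws ! j, qs ! (\<alpha> ! j))) \<longleftrightarrow>
          lexless (r (ws ! i), map snd qs ! (\<alpha> ! i)) (r (ws ! j), map snd qs ! (\<alpha> ! j))" if "i < k" "j < k" for i j
      proof (cases "i = j")
        case False
        then show ?thesis
          using enc_less(2)[of "ws ! i" "ws ! j" "qs ! (\<alpha> ! i)" "qs ! (\<alpha> ! j)"] mem ne[of i j] ai that lens by simp
      qed (simp add: lexless_def)
      then show ?thesis using lens by (auto simp: order_isomorphic_def k_def)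
    qed
    show ?thesis unfolding good_def cell_cond_def using 1 2 by (simp add: k_def)
  qed
  have "card (?S ?D) = (\<Sum>vs\<in>?D. card {ws \<in> cell_lists W k. good ws vs})"
    by (rule card_SigmaI) (use finD in auto)
  also have "\<dots> = (\<Sum>(qs, \<alpha>)\<in>sorted_lists V k \<times> perms k. card {ws \<in> cell_lists W k. good ws (map ((!) qs) \<alpha>)})"
    by (subst sum.reindex_bij_betw[OF bij_betw_distinct_lists[OF V], symmetric]) (simp add: case_prod_unfold)
  also have "\<dots> = (\<Sum>(qs, \<alpha>)\<in>sorted_lists V k \<times> perms k. card {ws \<in> cell_lists W k. cell_cond c r \<sigma> (map snd qs) \<alpha> ws})"
    by (rule sum.cong[OF refl]) (auto simp: good_iff intro!: arg_cong[of _ _ card])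
  also have "\<dots> = (\<Sum>qs\<in>sorted_lists V k. cell_count c r W \<sigma> (map snd qs))"
    by (simp add: sum.cartesian_product cell_count_def k_def)
  \<comment> \<open>The guard on the length makes the summand invariant under order isomorphism for
    all lists, including those of the wrong length, to which \<open>cell_cond_cong\<close> does not
    apply.\<close>
  also have "\<dots> = (\<Sum>qs\<in>sorted_lists V k. if length (map snd qs) = k then cell_count c r W \<sigma> (map snd qs) else 0)"
    by (rule sum.cong) (auto simp: sorted_lists_def)
  also have "\<dots> = (\<Sum>\<pi>\<in>perms k. occ V \<pi> * (if length \<pi> = k then cell_count c r W \<sigma> \<pi> else 0))"
  proof (rule sum_sorted_lists_by_pattern[OF V])
    fix \<rho> \<rho>' :: "nat list" assume iso: "order_isomorphic \<rho> \<rho>'"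
    then have l: "length \<rho> = length \<rho>'" by (rule order_isomorphicD(1))
    show "(if length \<rho> = k then cell_count c r W \<sigma> \<rho> else 0) = (if length \<rho>' = k then cell_count c r W \<sigma> \<rho>' else 0)"
      using cell_cond_cong[OF iso, of \<sigma>] l unfolding cell_count_def k_def by (auto intro!: sum.cong arg_cong[of _ _ card])
  qed
  also have "\<dots> = (\<Sum>\<pi>\<in>perms k. occ V \<pi> * cell_count c r W \<sigma> \<pi>)"
    by (rule sum.cong) (auto simp: permsD)
  finally have main: "card (?S ?D) = (\<Sum>\<pi>\<in>perms k. occ V \<pi> * cell_count c r W \<sigma> \<pi>)" .
  have cD: "card ?D = fact k * (card V choose k)"
  proof -
    have "card ?D = card (sorted_lists V k) * card (perms k)"
      using bij_betw_same_card[OF bij_betw_distinct_lists[OF V, of k]] by (simp only: card_cartesian_product)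
    also have "\<dots> = fact k * (card V choose k)"
      by (simp only: card_sorted_lists[OF V] card_permutations_of_set finite_lessThan card_lessThan mult.commute[of "fact k"])
    finally show ?thesis .
  qed
  have cW: "card (cell_lists W k) = card W ^ k"
    using card_lists_length_eq[OF W, of k] by (simp add: cell_lists_def)
  have "card ?N + card ?D = card V ^ k"
  proof -
    have "?N \<union> ?D = {vs. set vs \<subseteq> V \<and> length vs = k}" by auto
    moreover have "card (?N \<union> ?D) = card ?N + card ?D" using finD by (intro card_Un_disjoint) auto
    ultimately show ?thesis using card_lists_length_eq[OF finV, of k] by simp
  qed
  then have NV: "card W ^ k * card ?N + card W ^ k * card ?D = card W ^ k * card V ^ k"
    by (simp only: distrib_left[symmetric])
  have "card (?S ?N) \<le> card (?N \<times> cell_lists W k)"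
    using finD by (intro card_mono) auto
  also have "\<dots> = card W ^ k * card ?N"
    by (simp only: card_cartesian_product cW mult.commute[of "card ?N"])
  finally have "card (?S ?N) + card W ^ k * card ?D \<le> card W ^ k * card V ^ k"
    unfolding NV[symmetric] by (rule add_right_mono)
  then have "card (?S ?N) + card W ^ k * (fact k * (card V choose k)) \<le> card W ^ k * card V ^ k"
    by (simp only: cD)
  with total[unfolded main] show ?thesis by (intro exI[of _ "card (?S ?N)"] conjI)
qed

end

section \<open>Limits of pattern counts\<close>

text \<open>\<open>A j\<close> has about \<open>m * j\<close> points. Scaling by powers of
  \<open>j\<close> instead of the size lets masses add and counts convolve under sums without
  renormalization.\<close>

definition profile :: "(nat \<Rightarrow> (nat \<times> nat) set) \<Rightarrow> real \<Rightarrow> (nat list \<Rightarrow> real) \<Rightarrow> bool" where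
  "profile A m \<phi> \<longleftrightarrow> (\<forall>j. point_set (A j)) \<and> (\<lambda>j. real (card (A j)) / real j) \<longlonglongrightarrow> m \<and>
    (\<forall>\<sigma>. (\<lambda>j. real (occ (A j) \<sigma>) / real j ^ length \<sigma>) \<longlonglongrightarrow> \<phi> \<sigma>)"

definition conv :: "(nat \<Rightarrow> nat \<Rightarrow> bool) \<Rightarrow> (nat list \<Rightarrow> real) \<Rightarrow> (nat list \<Rightarrow> real) \<Rightarrow> nat list \<Rightarrow> real" where
  "conv R \<phi> \<phi>' \<sigma> = (\<Sum>i\<le>length \<sigma>. if separates R i \<sigma> then \<phi> (take i \<sigma>) * \<phi>' (drop i \<sigma>) else 0)"

definition mono_profile :: "(nat \<Rightarrow> nat \<Rightarrow> bool) \<Rightarrow> real \<Rightarrow> nat list \<Rightarrow> real" where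
  "mono_profile R m \<sigma> = (if sorted_wrt R \<sigma> then m ^ length \<sigma> / fact (length \<sigma>) else 0)"

text \<open>The binomial coefficient is, up to \<open>fact k\<close>, a product of \<open>k\<close>
  factors, each of which tends to \<open>m\<close> after division by \<open>j\<close>.\<close>

lemma tendsto_binomial:
  assumes "(\<lambda>j. real (f j) / real j) \<longlonglongrightarrow> m"
  shows "(\<lambda>j. real (f j choose k) / real j ^ k) \<longlonglongrightarrow> m ^ k / fact k"
proof -
  have "(\<lambda>j. (real (f j) - real i) / real j) \<longlonglongrightarrow> m" for i
  proof -
    have "(\<lambda>j. real (f j) / real j - real i / real j) \<longlonglongrightarrow> m - 0"
      by (intro tendsto_diff assms lim_const_over_n)
    then show ?thesis by (simp add: diff_divide_distrib)
  qed
  then have "(\<lambda>j. (\<Prod>i=0..<k. (real (f j) - real i) / real j) / fact k) \<longlonglongrightarrow> (\<Prod>i=0..<k. m) / fact k"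
    by (intro tendsto_divide tendsto_prod tendsto_const) auto
  moreover have "(\<Prod>i=0..<k. (real (f j) - real i) / real j) / fact k = real (f j choose k) / real j ^ k" for j
    by (simp add: binomial_gbinomial gbinomial_prod_rev prod_dividef)
  ultimately show ?thesis by simp
qed

lemma tendsto_conv:
  assumes A: "profile A m \<phi>" and B: "profile B m' \<phi>'"
  shows "(\<lambda>j. real (\<Sum>i\<le>length \<sigma>. if separates R i \<sigma> then occ (A j) (take i \<sigma>) * occ (B j) (drop i \<sigma>) else 0) /
    real j ^ length \<sigma>) \<longlonglongrightarrow> conv R \<phi> \<phi>' \<sigma>"
proof -
  let ?t = "\<lambda>j i. (real (occ (A j) (take i \<sigma>)) / real j ^ length (take i \<sigma>)) *
    (real (occ (B j) (drop i \<sigma>)) / real j ^ length (drop i \<sigma>))"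
  have "(\<lambda>j. \<Sum>i\<le>length \<sigma>. if separates R i \<sigma> then ?t j i else 0) \<longlonglongrightarrow> conv R \<phi> \<phi>' \<sigma>"
    unfolding conv_def
  proof (rule tendsto_sum)
    fix i
    have "(\<lambda>j. ?t j i) \<longlonglongrightarrow> \<phi> (take i \<sigma>) * \<phi>' (drop i \<sigma>)"
      using A B by (intro tendsto_mult) (auto simp only: profile_def)
    then show "(\<lambda>j. if separates R i \<sigma> then ?t j i else 0)
      \<longlonglongrightarrow> (if separates R i \<sigma> then \<phi> (take i \<sigma>) * \<phi>' (drop i \<sigma>) else 0)"
      by (cases "separates R i \<sigma>") simp_all
  qed
  moreover have "(\<Sum>i\<le>length \<sigma>. if separates R i \<sigma> then ?t j i else 0)
    = real (\<Sum>i\<le>length \<sigma>. if separates R i \<sigma> then occ (A j) (take i \<sigma>) * occ (B j) (drop i \<sigma>) else 0) / real j ^ length \<sigma>" for j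
    unfolding of_nat_sum sum_divide_distrib
  proof (rule sum.cong[OF refl])
    fix i assume "i \<in> {..length \<sigma>}"
    then have "real j ^ length \<sigma> = real j ^ i * real j ^ (length \<sigma> - i)"
      by (simp flip: power_add)
    with \<open>i \<in> _\<close> show "(if separates R i \<sigma> then ?t j i else 0) =
      real (if separates R i \<sigma> then occ (A j) (take i \<sigma>) * occ (B j) (drop i \<sigma>) else 0) / real j ^ length \<sigma>"
      by simp
  qed
  ultimately show ?thesis by simp
qed

lemma profile_dsum:
  assumes A: "profile A m \<phi>" and B: "profile B m' \<phi>'"
  shows "profile (\<lambda>j. dsum (A j) (B j)) (m + m') (conv (<) \<phi> \<phi>')"
  unfolding profile_def
proof (intro conjI allI)
  have ps: "point_set (A j)" "point_set (B j)" for j using A B by (auto simp: profile_def)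
  show "point_set (dsum (A j) (B j))" for j by (rule dsum(1)[OF ps])
  show "(\<lambda>j. real (card (dsum (A j) (B j))) / real j) \<longlonglongrightarrow> m + m'"
    using A B by (simp add: dsum(2)[OF ps] add_divide_distrib profile_def tendsto_add)
  show "(\<lambda>j. real (occ (dsum (A j) (B j)) \<sigma>) / real j ^ length \<sigma>) \<longlonglongrightarrow> conv (<) \<phi> \<phi>' \<sigma>" for \<sigma>
    unfolding dsum(3)[OF ps] by (rule tendsto_conv[OF A B])
qed

lemma profile_ssum:
  assumes A: "profile A m \<phi>" and B: "profile B m' \<phi>'"
  shows "profile (\<lambda>j. ssum (A j) (B j)) (m + m') (conv (>) \<phi> \<phi>')"
  unfolding profile_def
proof (intro conjI allI)
  have ps: "point_set (A j)" "point_set (B j)" for j using A B by (auto simp: profile_def)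
  show "point_set (ssum (A j) (B j))" for j by (rule ssum(1)[OF ps])
  show "(\<lambda>j. real (card (ssum (A j) (B j))) / real j) \<longlonglongrightarrow> m + m'"
    using A B by (simp add: ssum(2)[OF ps] add_divide_distrib profile_def tendsto_add)
  show "(\<lambda>j. real (occ (ssum (A j) (B j)) \<sigma>) / real j ^ length \<sigma>) \<longlonglongrightarrow> conv (>) \<phi> \<phi>' \<sigma>" for \<sigma>
    unfolding ssum(3)[OF ps] by (rule tendsto_conv[OF A B])
qed

lemma profile_incr:
  assumes "(\<lambda>j. real (f j) / real j) \<longlonglongrightarrow> m"
  shows "profile (\<lambda>j. incr (f j)) m (mono_profile (<) m)"
  using assms tendsto_binomial[OF assms] by (auto simp: profile_def incr mono_profile_def)

lemma profile_decr:
  assumes "(\<lambda>j. real (f j) / real j) \<longlonglongrightarrow> m"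
  shows "profile (\<lambda>j. decr (f j)) m (mono_profile (>) m)"
  using assms tendsto_binomial[OF assms] by (auto simp: profile_def decr mono_profile_def)

text \<open>The main sum of \<open>occ_tile\<close> converges term by term, and the lists with a
  repeated template point are of lower order.\<close>

lemma profile_tile:
  assumes W: "finite W" "inj_on idx W" "\<And>w. w \<in> W \<Longrightarrow> idx w < L" and V: "profile V v \<phi>"
  shows "profile (\<lambda>j. tile c r idx L W (V j)) (real (card W) * v)
    (\<lambda>\<sigma>. \<Sum>\<pi>\<in>perms (length \<sigma>). \<phi> \<pi> * real (cell_count c r W \<sigma> \<pi>))"
  unfolding profile_def
proof (intro conjI allI)
  have ps: "point_set (V j)" for j using V by (simp add: profile_def)
  have card: "(\<lambda>j. real (card (V j)) / real j) \<longlonglongrightarrow> v" using V by (simp add: profile_def)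
  show "point_set (tile c r idx L W (V j))" for j by (rule tile(1)[OF W ps])
  show "(\<lambda>j. real (card (tile c r idx L W (V j))) / real j) \<longlonglongrightarrow> real (card W) * v"
    using tendsto_mult[OF tendsto_const card, of "real (card W)"] by (simp add: tile(2)[OF W ps])
  fix \<sigma> :: "nat list"
  let ?k = "length \<sigma>"
  let ?M = "\<lambda>j. \<Sum>\<pi>\<in>perms ?k. occ (V j) \<pi> * cell_count c r W \<sigma> \<pi>"
  have "\<forall>j. \<exists>e. occ (tile c r idx L W (V j)) \<sigma> = ?M j + e \<and>
    e + card W ^ ?k * (fact ?k * (card (V j) choose ?k)) \<le> card W ^ ?k * card (V j) ^ ?k"
    by (rule allI) (rule occ_tile[OF W ps])
  from choice[OF this] obtain e where e': "\<forall>j. occ (tile c r idx L W (V j)) \<sigma> = ?M j + e j \<and>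
    e j + card W ^ ?k * (fact ?k * (card (V j) choose ?k)) \<le> card W ^ ?k * card (V j) ^ ?k" ..
  have e: "occ (tile c r idx L W (V j)) \<sigma> = ?M j + e j"
    "e j + card W ^ ?k * (fact ?k * (card (V j) choose ?k)) \<le> card W ^ ?k * card (V j) ^ ?k" for j
    using e'[rule_format, of j] by (rule conjunct1, rule conjunct2)
  have main: "(\<lambda>j. real (?M j) / real j ^ ?k) \<longlonglongrightarrow> (\<Sum>\<pi>\<in>perms ?k. \<phi> \<pi> * real (cell_count c r W \<sigma> \<pi>))"
  proof -
    have "(\<lambda>j. \<Sum>\<pi>\<in>perms ?k. (real (occ (V j) \<pi>) / real j ^ length \<pi>) * real (cell_count c r W \<sigma> \<pi>))
        \<longlonglongrightarrow> (\<Sum>\<pi>\<in>perms ?k. \<phi> \<pi> * real (cell_count c r W \<sigma> \<pi>))"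
      using V by (intro tendsto_sum tendsto_mult tendsto_const) (auto simp: profile_def)
    moreover have "(\<Sum>\<pi>\<in>perms ?k. (real (occ (V j) \<pi>) / real j ^ length \<pi>) * real (cell_count c r W \<sigma> \<pi>)) =
        real (?M j) / real j ^ ?k" for j
      unfolding of_nat_sum sum_divide_distrib by (rule sum.cong) (auto simp: permsD)
    ultimately show ?thesis by simp
  qed
  let ?u = "\<lambda>j. real (card W) ^ ?k * ((real (card (V j)) / real j) ^ ?k - fact ?k * (real (card (V j) choose ?k) / real j ^ ?k))"
  have "(\<lambda>j. real (e j) / real j ^ ?k) \<longlonglongrightarrow> 0"
  proof (rule tendsto_sandwich[where f = "\<lambda>_. 0" and h = ?u])
    show "\<forall>\<^sub>F j in sequentially. real (e j) / real j ^ ?k \<le> ?u j"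
    proof (rule always_eventually, rule allI)
      fix j
      have "real (e j + card W ^ ?k * (fact ?k * (card (V j) choose ?k))) \<le> real (card W ^ ?k * card (V j) ^ ?k)"
        using e(2)[of j] by (rule of_nat_mono)
      then have "real (e j) \<le> real (card W) ^ ?k * (real (card (V j)) ^ ?k - fact ?k * real (card (V j) choose ?k))"
        by (simp only: of_nat_add of_nat_mult of_nat_power of_nat_fact right_diff_distrib le_diff_eq)
      then have "real (e j) / real j ^ ?k \<le> real (card W) ^ ?k * (real (card (V j)) ^ ?k - fact ?k * real (card (V j) choose ?k)) / real j ^ ?k"
        by (rule divide_right_mono) simp
      also have "\<dots> = ?u j" by (simp only: power_divide times_divide_eq_right diff_divide_distrib[symmetric])
      finally show "real (e j) / real j ^ ?k \<le> ?u j" .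
    qed
    \<comment> \<open>The powers of \<open>card (V j)\<close> and the binomial coefficients times
      the factorial have the same leading term, so the bound tends to 0.\<close>
    have "?u \<longlonglongrightarrow> real (card W) ^ ?k * (v ^ ?k - fact ?k * (v ^ ?k / fact ?k))"
      by (rule tendsto_mult[OF tendsto_const tendsto_diff[OF tendsto_power[OF card] tendsto_mult[OF tendsto_const tendsto_binomial[OF card]]]])
    then show "?u \<longlonglongrightarrow> 0" by simp
  qed (auto intro!: always_eventually)
  from tendsto_add[OF main this]
  show "(\<lambda>j. real (occ (tile c r idx L W (V j)) \<sigma>) / real j ^ ?k) \<longlonglongrightarrow>
      (\<Sum>\<pi>\<in>perms ?k. \<phi> \<pi> * real (cell_count c r W \<sigma> \<pi>))"
    unfolding e(1) of_nat_add add_divide_distrib by simp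
qed

lemma tendsto_pattern_density:
  assumes A: "profile A m \<phi>" and m: "m > 0"
  shows "(\<lambda>j. real (occ (A j) \<sigma>) / real (card (A j) choose length \<sigma>)) \<longlonglongrightarrow> \<phi> \<sigma> * fact (length \<sigma>) / m ^ length \<sigma>"
proof -
  let ?k = "length \<sigma>"
  have "(\<lambda>j. (real (occ (A j) \<sigma>) / real j ^ ?k) / (real (card (A j) choose ?k) / real j ^ ?k)) \<longlonglongrightarrow> \<phi> \<sigma> / (m ^ ?k / fact ?k)"
    using A m by (intro tendsto_divide tendsto_binomial) (auto simp: profile_def)
  moreover have "\<forall>\<^sub>F j in sequentially. (real (occ (A j) \<sigma>) / real j ^ ?k) / (real (card (A j) choose ?k) / real j ^ ?k) =
      real (occ (A j) \<sigma>) / real (card (A j) choose ?k)"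
    using eventually_gt_at_top[of 0] by eventually_elim simp
  ultimately have "(\<lambda>j. real (occ (A j) \<sigma>) / real (card (A j) choose ?k)) \<longlonglongrightarrow> \<phi> \<sigma> / (m ^ ?k / fact ?k)"
    by (rule Lim_transform_eventually)
  then show ?thesis by simp
qed

lemma profile_card_at_top:
  assumes A: "profile A m \<phi>" and m: "m > 0"
  shows "filterlim (\<lambda>j. card (A j)) at_top sequentially"
proof -
  have fl: "filterlim (\<lambda>j. (real (card (A j)) / real j) * real j) at_top sequentially"
    using A m by (intro filterlim_tendsto_pos_mult_at_top[of _ m] filterlim_real_sequentially) (auto simp: profile_def)
  have ev: "\<forall>\<^sub>F j in sequentially. (real (card (A j)) / real j) * real j = real (card (A j))"
    using eventually_gt_at_top[of 0] by eventually_elim simp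
  have "filterlim (\<lambda>j. real (card (A j))) at_top sequentially"
    using filterlim_cong[OF refl refl ev, of at_top] fl by blast
  then show ?thesis by (simp add: filterlim_sequentially_iff_filterlim_real)
qed

text \<open>Reduces the claim to the limits of a single family of point sets; its members become the
  sequence of permutations.\<close>

lemma not_quasirandom_forcing_if_profile:
  assumes A: "profile A m \<phi>" and m: "m > 0"
    and S: "\<And>\<sigma>. \<sigma> \<in> S \<Longrightarrow> \<phi> \<sigma> * fact (length \<sigma>) / m ^ length \<sigma> = 1 / fact (length \<sigma>)"
    and \<tau>: "is_permutation \<tau>" "\<phi> \<tau> * fact (length \<tau>) / m ^ length \<tau> \<noteq> 1 / fact (length \<tau>)"
  shows "\<not> quasirandom_forcing S"
proof
  assume qf: "quasirandom_forcing S"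
  have "\<forall>j. \<exists>\<pi>. is_permutation \<pi> \<and> length \<pi> = card (A j) \<and>
    (\<forall>\<sigma>. pattern_density \<sigma> \<pi> = real (occ (A j) \<sigma>) / real (card (A j) choose length \<sigma>))"
    using permutation_of_point_set A by (simp add: profile_def)
  then obtain \<pi> where \<pi>: "\<And>j. is_permutation (\<pi> j)" "\<And>j. length (\<pi> j) = card (A j)"
    "\<And>j \<sigma>. pattern_density \<sigma> (\<pi> j) = real (occ (A j) \<sigma>) / real (card (A j) choose length \<sigma>)"
    by metis
  have lim: "(\<lambda>j. pattern_density \<sigma> (\<pi> j)) \<longlonglongrightarrow> \<phi> \<sigma> * fact (length \<sigma>) / m ^ length \<sigma>" for \<sigma>
    unfolding \<pi>(3) by (rule tendsto_pattern_density[OF A m])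
  have "(\<lambda>j. pattern_density \<sigma> (\<pi> j)) \<longlonglongrightarrow> 1 / fact (length \<sigma>)" if "\<sigma> \<in> S" for \<sigma>
    using lim[of \<sigma>] S[OF that] by simp
  moreover have "filterlim (\<lambda>j. length (\<pi> j)) at_top sequentially"
    using profile_card_at_top[OF A m] by (simp add: \<pi>(2))
  ultimately have "(\<lambda>j. pattern_density \<tau> (\<pi> j)) \<longlonglongrightarrow> 1 / fact (length \<tau>)"
    using qf \<pi>(1) \<tau>(1) unfolding quasirandom_forcing_def by blast
  with lim[of \<tau>] \<tau>(2) show False using LIMSEQ_unique by blast
qed

section \<open>Counting cell lists by inclusion and exclusion\<close>

fun adj :: "nat list \<Rightarrow> bool list" where
  "adj (u # v # us) = (u < v) # adj (v # us)"
| "adj us = []"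

fun chain :: "nat list \<Rightarrow> bool list \<Rightarrow> bool" where
  "chain (a # b # cs) (d # ds) \<longleftrightarrow> (a < b \<or> a = b \<and> d) \<and> chain (b # cs) ds"
| "chain cs ds \<longleftrightarrow> True"

text \<open>As \<open>lexless\<close> is transitive, only neighbours matter; a tie of first
  components is allowed exactly at an ascent of \<open>us\<close>, which \<open>adj\<close>
  records.\<close>

lemma sorted_wrt_lexless_iff_chain:
  "length cs = length us \<Longrightarrow> sorted_wrt lexless (zip cs us) \<longleftrightarrow> chain cs (adj us)"
proof (induction cs us rule: list_induct2)
  case (Cons a cs u us)
  have tr: "transp lexless" by (auto simp: transp_def lexless_def)
  have IH: "sorted_wrt lexless (zip cs us) \<longleftrightarrow> chain cs (adj us)" by (rule Cons.IH)
  show ?case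
  proof (cases cs)
    case (Cons b cs')
    then obtain v us' where us: "us = v # us'" using \<open>length cs = length us\<close> by (cases us) auto
    have "sorted_wrt lexless (zip (a # cs) (u # us)) \<longleftrightarrow> lexless (a, u) (b, v) \<and> sorted_wrt lexless (zip cs us)"
      by (simp only: Cons us zip_Cons_Cons sorted_wrt2[OF tr])
    also have "\<dots> \<longleftrightarrow> chain (a # cs) (adj (u # us))"
      unfolding IH by (simp only: Cons us chain.simps adj.simps lexless_def fst_conv snd_conv)
    finally show ?thesis .
  qed (use \<open>length cs = length us\<close> in simp)
qed simp

text \<open>\<open>\<tau>\<close> lists the positions of \<open>\<sigma>\<close> by increasing
  value. Agreement with \<open>\<sigma>\<close> on all pairs thus means being sorted along
  \<open>\<tau>\<close>; the negative comparisons follow from transitivity and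
  irreflexivity.\<close>

lemma less_iff_sorted_by_positions:
  fixes \<sigma> :: "nat list"
  assumes tr: "transp L" and irr: "irreflp L"
    and \<tau>: "length \<tau> = length \<sigma>" "set \<tau> = {..<length \<sigma>}" "sorted_wrt (<) (map ((!) \<sigma>) \<tau>)"
  shows "(\<forall>i<length \<sigma>. \<forall>j<length \<sigma>. L (f i) (f j) \<longleftrightarrow> \<sigma> ! i < \<sigma> ! j) \<longleftrightarrow> sorted_wrt L (map f \<tau>)"
    (is "?A \<longleftrightarrow> ?B")
proof
  assume A: ?A
  show ?B unfolding sorted_wrt_map
    by (rule sorted_wrt_mono_rel[OF _ \<tau>(3)[unfolded sorted_wrt_map]]) (use A \<tau>(2) in auto)
next
  assume B: ?B
  have pos: "\<exists>a<length \<tau>. \<tau> ! a = i" if "i < length \<sigma>" for i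
    using that \<tau>(2) by (metis in_set_conv_nth lessThan_iff)
  have LL: "L (f (\<tau> ! a)) (f (\<tau> ! b))" "\<sigma> ! (\<tau> ! a) < \<sigma> ! (\<tau> ! b)" if "a < b" "b < length \<tau>" for a b
    using B \<tau>(3) that unfolding sorted_wrt_iff_nth_less by auto
  show ?A
  proof (intro allI impI)
    fix i j assume "i < length \<sigma>" "j < length \<sigma>"
    then obtain a b where ab: "a < length \<tau>" "\<tau> ! a = i" "b < length \<tau>" "\<tau> ! b = j" using pos by blast
    show "L (f i) (f j) \<longleftrightarrow> \<sigma> ! i < \<sigma> ! j"
    proof (cases a b rule: linorder_cases)
      case less then show ?thesis using LL[of a b] ab by simp
    next
      case equal
      then have "i = j" using ab by simp
      then show ?thesis using irr by (simp add: irreflp_def)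
    next
      case greater
      then have "L (f j) (f i)" "\<sigma> ! j < \<sigma> ! i" using LL[of b a] ab by auto
      then show ?thesis using tr irr by (metis irreflp_def less_asym transpE)
    qed
  qed
qed

text \<open>The condition splits into one on the columns, read from left to right, and one on the
  rows, read from bottom to top along \<open>\<tau>\<close>.\<close>

lemma cell_cond_iff_chain:
  assumes \<tau>: "length \<tau> = length \<sigma>" "set \<tau> = {..<length \<sigma>}" "sorted_wrt (<) (map ((!) \<sigma>) \<tau>)"
    and ws: "length ws = length \<sigma>" and \<alpha>: "length \<alpha> = length \<sigma>"
  shows "cell_cond c r \<sigma> \<rho> \<alpha> ws \<longleftrightarrow>
    chain (map c ws) (adj \<alpha>) \<and> chain (map ((!) (map r ws)) \<tau>) (adj (map (\<lambda>i. \<rho> ! (\<alpha> ! i)) \<tau>))"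
proof -
  have tr: "transp lexless" "irreflp lexless" by (auto simp: transp_def irreflp_def lexless_def)
  have 1: "(\<forall>j<length \<sigma>. \<forall>i<j. lexless (c (ws ! i), \<alpha> ! i) (c (ws ! j), \<alpha> ! j)) \<longleftrightarrow> chain (map c ws) (adj \<alpha>)"
    using ws \<alpha> by (subst sorted_wrt_lexless_iff_chain[symmetric]) (auto simp: sorted_wrt_iff_nth_less)
  let ?f = "\<lambda>i. (r (ws ! i), \<rho> ! (\<alpha> ! i))"
  have 2: "map ?f \<tau> = zip (map ((!) (map r ws)) \<tau>) (map (\<lambda>i. \<rho> ! (\<alpha> ! i)) \<tau>)"
    using ws \<tau>(2) by (auto simp: zip_map_map zip_same_conv_map)
  show ?thesis
    unfolding cell_cond_def 1 less_iff_sorted_by_positions[OF tr \<tau>, of ?f] 2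
    by (subst sorted_wrt_lexless_iff_chain) auto
qed

lemma cell_lists_0: "cell_lists W 0 = {[]}"
  by (auto simp: cell_lists_def)

lemma sum_cell_lists_Suc:
  "finite W \<Longrightarrow> (\<Sum>ws\<in>cell_lists W (Suc k). g ws) = (\<Sum>w\<in>W. \<Sum>ws\<in>cell_lists W k. g (w # ws))"
proof -
  assume "finite W"
  have "bij_betw (\<lambda>(w, ws). w # ws) (W \<times> cell_lists W k) (cell_lists W (Suc k))"
    by (auto simp: bij_betw_def inj_on_def cell_lists_def image_iff length_Suc_conv)
  from sum.reindex_bij_betw[OF this, of g]
  show ?thesis by (simp add: sum.cartesian_product case_prod_unfold)
qed

lemma length_cell_lists: "ws \<in> cell_lists W k \<Longrightarrow> length ws = k"
  by (simp add: cell_lists_def)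

lemma finite_cell_lists: "finite W \<Longrightarrow> finite (cell_lists W k)"
  unfolding cell_lists_def by (rule finite_lists_length_eq)

section \<open>The grid of cells and the expansion of its multiplicities\<close>

definition side :: "nat \<Rightarrow> nat" where
  "side c = (if c = 0 \<or> c = 11 then 1 else 0)"

text \<open>The third component numbers the copies in a cell; the product of the two
  \<open>side\<close> values is 1 exactly at the four corners.\<close>

definition cells :: "(nat \<times> nat \<times> nat) set" where
  "cells = (SIGMA c:{..<12}. SIGMA r:{..<12}. {..<8 - side c * side r})"

abbreviation row :: "nat \<times> nat \<times> nat \<Rightarrow> nat" where
  "row w \<equiv> fst (snd w)"

abbreviation nums :: "nat \<Rightarrow> nat list set" where
  "nums k \<equiv> cell_lists {..<12} k"

lemma finite_cells: "finite cells"
  unfolding cells_def by auto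

lemma sum_cells:
  fixes g :: "nat \<Rightarrow> nat \<Rightarrow> int"
  shows "(\<Sum>w\<in>cells. g (fst w) (row w)) = (\<Sum>c<12. \<Sum>r<12. (8 - int (side c) * int (side r)) * g c r)"
proof -
  have S1: "(\<Sum>w\<in>Sigma A B. h w) = (\<Sum>x\<in>A. \<Sum>y\<in>B x. h (x, y))" if "finite A" "\<And>x. finite (B x)"
    for A :: "nat set" and B :: "nat \<Rightarrow> (nat \<times> nat) set" and h :: "nat \<times> nat \<times> nat \<Rightarrow> int"
    using that by (simp add: sum.Sigma)
  have S2: "(\<Sum>w\<in>Sigma A B. h w) = (\<Sum>x\<in>A. \<Sum>y\<in>B x. h (x, y))" if "finite A" "\<And>x. finite (B x)"
    for A :: "nat set" and B :: "nat \<Rightarrow> nat set" and h :: "nat \<times> nat \<Rightarrow> int"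
    using that by (simp add: sum.Sigma)
  have "(\<Sum>w\<in>cells. g (fst w) (row w)) = (\<Sum>c<12. \<Sum>r<12. \<Sum>i<8 - side c * side r. g c r)"
    unfolding cells_def by (simp only: S1 S2 finite_SigmaI finite_lessThan fst_conv snd_conv)
  also have "\<dots> = (\<Sum>c<12. \<Sum>r<12. (8 - int (side c) * int (side r)) * g c r)"
    by (intro sum.cong refl) (auto simp: side_def)
  finally show ?thesis .
qed

text \<open>The summand does not see the copy numbers; summing over them leaves the product of the
  multiplicities.\<close>

lemma sum_cell_lists_cells:
  fixes f :: "nat list \<Rightarrow> nat list \<Rightarrow> int"
  shows "(\<Sum>ws\<in>cell_lists cells k. f (map fst ws) (map row ws)) =
    (\<Sum>cs\<in>nums k. \<Sum>rs\<in>nums k. prod_list (map2 (\<lambda>c r. 8 - int (side c) * int (side r)) cs rs) * f cs rs)"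
proof (induction k arbitrary: f)
  case 0
  show ?case by (simp add: cell_lists_0)
next
  case (Suc k)
  let ?m = "\<lambda>c r. 8 - int (side c) * int (side r)"
  let ?p = "\<lambda>cs rs. prod_list (map2 ?m cs rs)"
  have "(\<Sum>ws\<in>cell_lists cells (Suc k). f (map fst ws) (map row ws)) =
      (\<Sum>w\<in>cells. \<Sum>ws\<in>cell_lists cells k. f (fst w # map fst ws) (row w # map row ws))"
    by (simp add: sum_cell_lists_Suc finite_cells)
  also have "\<dots> = (\<Sum>w\<in>cells. \<Sum>cs\<in>nums k. \<Sum>rs\<in>nums k. ?p cs rs * f (fst w # cs) (row w # rs))"
    by (rule sum.cong[OF refl], rule Suc.IH)
  also have "\<dots> = (\<Sum>c<12. \<Sum>r<12. ?m c r * (\<Sum>cs\<in>nums k. \<Sum>rs\<in>nums k. ?p cs rs * f (c # cs) (r # rs)))"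
    by (rule sum_cells)
  also have "\<dots> = (\<Sum>c<12. \<Sum>r<12. \<Sum>cs\<in>nums k. \<Sum>rs\<in>nums k. ?p (c # cs) (r # rs) * f (c # cs) (r # rs))"
    by (simp add: sum_distrib_left mult.assoc)
  also have "\<dots> = (\<Sum>c<12. \<Sum>cs\<in>nums k. \<Sum>r<12. \<Sum>rs\<in>nums k. ?p (c # cs) (r # rs) * f (c # cs) (r # rs))"
    by (rule sum.cong[OF refl], rule sum.swap)
  also have "\<dots> = (\<Sum>cs\<in>nums (Suc k). \<Sum>rs\<in>nums (Suc k). ?p cs rs * f cs rs)"
    by (simp add: sum_cell_lists_Suc)
  finally show ?case .
qed

abbreviation bools :: "nat \<Rightarrow> bool list set" where
  "bools k \<equiv> cell_lists UNIV k"

text \<open>In a product of factors \<open>8 - x * y\<close>, the flags \<open>as\<close> mark those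
  from which \<open>- x * y\<close> is taken. The marked terms give one \<open>wprod\<close> for the
  columns and one for the rows; the signs and the powers of 8 form \<open>coef\<close>.\<close>

definition wprod :: "bool list \<Rightarrow> nat list \<Rightarrow> int" where
  "wprod as cs = prod_list (map2 (\<lambda>a c. if a then int (side c) else 1) as cs)"

definition coef :: "bool list \<Rightarrow> int" where
  "coef as = prod_list (map (\<lambda>a. if a then - 1 else 8) as)"

lemma prod_cells_expand:
  "length cs = k \<Longrightarrow> length rs = k \<Longrightarrow>
    prod_list (map2 (\<lambda>c r. 8 - int (side c) * int (side r)) cs rs) =
    (\<Sum>as\<in>bools k. coef as * wprod as cs * wprod as rs)"
proof (induction k arbitrary: cs rs)
  case 0
  then show ?case by (simp add: cell_lists_0 coef_def wprod_def)
next
  case (Suc k)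
  then obtain c cs' r rs' where l: "cs = c # cs'" "rs = r # rs'" "length cs' = k" "length rs' = k"
    by (metis length_Suc_conv)
  have "(\<Sum>as\<in>bools (Suc k). coef as * wprod as cs * wprod as rs) =
      (\<Sum>a\<in>UNIV. \<Sum>as\<in>bools k. coef (a # as) * wprod (a # as) cs * wprod (a # as) rs)"
    by (rule sum_cell_lists_Suc) simp
  also have "\<dots> = (8 - int (side c) * int (side r)) * (\<Sum>as\<in>bools k. coef as * wprod as cs' * wprod as rs')"
    unfolding UNIV_bool l
    by (simp add: coef_def wprod_def sum_distrib_left algebra_simps sum_negf[symmetric] sum.distrib[symmetric])
  finally show ?case using Suc.IH[OF l(3,4)] by (simp add: l)
qed

text \<open>
  The multiplicity \<open>8 - side c * side r\<close> of a cell is expanded over all lists of cells; this decouples the columns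
  from the rows. \<open>XS\<close> is the resulting sum over columns, where the flags \<open>ds\<close> mark the steps that may be weak.
\<close>

definition XS :: "bool list \<Rightarrow> bool list \<Rightarrow> int" where
  "XS as ds = (\<Sum>cs\<in>nums (length as). of_bool (chain cs ds) * wprod as cs)"

lemma wprod_permute:
  assumes "length as = k" "length rs = k" "length \<tau> = k" "set \<tau> = {..<k}"
  shows "wprod (map ((!) as) \<tau>) (map ((!) rs) \<tau>) = wprod as rs"
proof -
  let ?g = "\<lambda>i. if as ! i then int (side (rs ! i)) else 1"
  have d: "distinct \<tau>" using assms by (intro card_distinct) simp
  have "wprod (map ((!) as) \<tau>) (map ((!) rs) \<tau>) = prod_list (map ?g \<tau>)"
    by (simp add: wprod_def zip_map_map zip_same_conv_map comp_def)
  also have "\<dots> = prod ?g {..<k}"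
    using prod.distinct_set_conv_list[OF d, of ?g] assms(4) by simp
  also have "\<dots> = prod_list (map ?g [0..<k])"
    using prod.distinct_set_conv_list[of "[0..<k]" ?g] by (simp add: lessThan_atLeast0)
  also have "map ?g [0..<k] = map2 (\<lambda>a c. if a then int (side c) else 1) as rs"
    using assms by (intro nth_equalityI) auto
  finally show ?thesis by (simp add: wprod_def)
qed

lemma bij_betw_permute_list:
  assumes "length \<tau> = k" "set \<tau> = {..<k}"
  shows "bij_betw (\<lambda>rs. map ((!) rs) \<tau>) (cell_lists W k) (cell_lists W k)"
proof (rule bij_betw_imageI)
  show inj: "inj_on (\<lambda>rs. map ((!) rs) \<tau>) (cell_lists W k)"
  proof (rule inj_onI)
    fix xs ys assume "xs \<in> cell_lists W k" "ys \<in> cell_lists W k" "map ((!) xs) \<tau> = map ((!) ys) \<tau>"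
    then show "xs = ys" using assms by (intro nth_equalityI) (auto simp: cell_lists_def)
  qed
  have d: "distinct \<tau>" using assms by (intro card_distinct) simp
  show "(\<lambda>rs. map ((!) rs) \<tau>) ` cell_lists W k = cell_lists W k"
  proof (intro equalityI subsetI)
    fix ys assume "ys \<in> (\<lambda>rs. map ((!) rs) \<tau>) ` cell_lists W k"
    then show "ys \<in> cell_lists W k" using assms by (auto simp: cell_lists_def subset_iff)
  next
    fix ys assume ys: "ys \<in> cell_lists W k"
    have bij: "bij_betw ((!) \<tau>) {..<k} {..<k}"
      using d assms by (metis bij_betw_nth)
    let ?inv = "inv_into {..<k} ((!) \<tau>)"
    let ?xs = "map (\<lambda>i. ys ! ?inv i) [0..<k]"
    have inv: "?inv i < k" if "i < k" for i
      using bij_betw_inv_into[OF bij] that by (auto simp: bij_betw_def)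
    have "?xs \<in> cell_lists W k" using ys inv by (auto simp: cell_lists_def subset_iff)
    moreover have "map ((!) ?xs) \<tau> = ys"
    proof (rule nth_equalityI)
      show "length (map ((!) ?xs) \<tau>) = length ys" using ys assms by (simp add: cell_lists_def)
      fix i assume "i < length (map ((!) ?xs) \<tau>)"
      then have i: "i < k" using assms by simp
      then have "\<tau> ! i < k" using assms nth_mem[of i \<tau>] by auto
      then show "map ((!) ?xs) \<tau> ! i = ys ! i"
        using i assms inv_into_f_f[OF bij_betw_imp_inj_on[OF bij], of i] by simp
    qed
    ultimately show "ys \<in> (\<lambda>rs. map ((!) rs) \<tau>) ` cell_lists W k" by force
  qed
qed

lemma sum_swap3:
  "(\<Sum>x\<in>A. \<Sum>y\<in>B. \<Sum>z\<in>C. h x y z) = (\<Sum>z\<in>C. \<Sum>x\<in>A. \<Sum>y\<in>B. (h x y z :: int))"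
proof -
  have "(\<Sum>x\<in>A. \<Sum>y\<in>B. \<Sum>z\<in>C. h x y z) = (\<Sum>x\<in>A. \<Sum>z\<in>C. \<Sum>y\<in>B. h x y z)"
    by (rule sum.cong[OF refl], rule sum.swap)
  also have "\<dots> = (\<Sum>z\<in>C. \<Sum>x\<in>A. \<Sum>y\<in>B. h x y z)"
    by (rule sum.swap)
  finally show ?thesis .
qed

text \<open>After the expansion, the conditions on columns and rows involve separate variables, so
  for each \<open>as\<close> the double sum factors. Relisting the rows along \<open>\<tau>\<close>
  turns the second factor into a value of \<open>XS\<close> as well.\<close>

lemma card_cell_cond:
  assumes \<tau>: "length \<tau> = length \<sigma>" "set \<tau> = {..<length \<sigma>}" "sorted_wrt (<) (map ((!) \<sigma>) \<tau>)"
    and \<alpha>: "length \<alpha> = length \<sigma>"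
  shows "int (card {ws \<in> cell_lists cells (length \<sigma>). cell_cond fst row \<sigma> \<rho> \<alpha> ws}) =
    (\<Sum>as\<in>bools (length \<sigma>). coef as * XS as (adj \<alpha>) * XS (map ((!) as) \<tau>) (adj (map (\<lambda>i. \<rho> ! (\<alpha> ! i)) \<tau>)))"
proof -
  let ?k = "length \<sigma>"
  let ?dx = "adj \<alpha>" and ?dy = "adj (map (\<lambda>i. \<rho> ! (\<alpha> ! i)) \<tau>)"
  let ?cx = "\<lambda>cs. of_bool (chain cs ?dx) :: int"
  let ?cy = "\<lambda>rs. of_bool (chain (map ((!) rs) \<tau>) ?dy) :: int"
  have fin: "finite (cell_lists cells ?k)" by (rule finite_cell_lists[OF finite_cells])
  have "int (card {ws \<in> cell_lists cells ?k. cell_cond fst row \<sigma> \<rho> \<alpha> ws}) =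
      (\<Sum>ws\<in>cell_lists cells ?k. of_bool (cell_cond fst row \<sigma> \<rho> \<alpha> ws))"
    using fin by (simp add: Collect_conj_eq Int_commute)
  also have "\<dots> = (\<Sum>ws\<in>cell_lists cells ?k. ?cx (map fst ws) * ?cy (map row ws))"
    by (rule sum.cong[OF refl]) (simp only: cell_cond_iff_chain[OF \<tau> length_cell_lists \<alpha>] of_bool_conj)
  also have "\<dots> = (\<Sum>cs\<in>nums ?k. \<Sum>rs\<in>nums ?k.
      prod_list (map2 (\<lambda>c r. 8 - int (side c) * int (side r)) cs rs) * (?cx cs * ?cy rs))"
    by (rule sum_cell_lists_cells)
  also have "\<dots> = (\<Sum>cs\<in>nums ?k. \<Sum>rs\<in>nums ?k. \<Sum>as\<in>bools ?k.
      coef as * ((?cx cs * wprod as cs) * (?cy rs * wprod as rs)))"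
    by (intro sum.cong refl) (simp add: prod_cells_expand[OF length_cell_lists length_cell_lists] sum_distrib_right mult_ac)
  also have "\<dots> = (\<Sum>as\<in>bools ?k. \<Sum>cs\<in>nums ?k. \<Sum>rs\<in>nums ?k.
      coef as * ((?cx cs * wprod as cs) * (?cy rs * wprod as rs)))"
    by (rule sum_swap3)
  also have "\<dots> = (\<Sum>as\<in>bools ?k. coef as * ((\<Sum>cs\<in>nums ?k. ?cx cs * wprod as cs) * (\<Sum>rs\<in>nums ?k. ?cy rs * wprod as rs)))"
    by (rule sum.cong[OF refl]) (unfold sum_product, simp only: sum_distrib_left)
  also have "\<dots> = (\<Sum>as\<in>bools ?k. coef as * XS as ?dx * XS (map ((!) as) \<tau>) ?dy)"
  proof (rule sum.cong[OF refl])
    fix as assume as: "as \<in> bools ?k"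
    have "(\<Sum>rs\<in>nums ?k. ?cy rs * wprod as rs) =
        (\<Sum>rs\<in>nums ?k. of_bool (chain (map ((!) rs) \<tau>) ?dy) * wprod (map ((!) as) \<tau>) (map ((!) rs) \<tau>))"
      by (rule sum.cong[OF refl]) (simp only: wprod_permute[OF length_cell_lists[OF as] length_cell_lists \<tau>(1,2)])
    also have "\<dots> = (\<Sum>rs\<in>nums ?k. of_bool (chain rs ?dy) * wprod (map ((!) as) \<tau>) rs)"
      by (rule sum.reindex_bij_betw[OF bij_betw_permute_list[OF \<tau>(1,2)]])
    finally show "coef as * ((\<Sum>cs\<in>nums ?k. ?cx cs * wprod as cs) * (\<Sum>rs\<in>nums ?k. ?cy rs * wprod as rs)) =
        coef as * XS as ?dx * XS (map ((!) as) \<tau>) ?dy"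
      using length_cell_lists[OF as] \<tau>(1) by (simp add: XS_def)
  qed
  finally show ?thesis .
qed

section \<open>Evaluation of the column sums\<close>

fun suf :: "int list \<Rightarrow> int list" where
  "suf [] = []"
| "suf (x # xs) = (case suf xs of [] \<Rightarrow> [x] | y # ys \<Rightarrow> (x + y) # y # ys)"

text \<open>A transfer recursion whose entry at \<open>c\<close> sums over the chains starting in
  column \<open>c\<close>. A weak step continues with the suffix sums from \<open>c\<close>, a
  strict one with those from \<open>c + 1\<close>, hence the tail padded by 0. The list with two
  ones tabulates \<open>side\<close>.\<close>

fun XL :: "bool list \<Rightarrow> bool list \<Rightarrow> int list" where
  "XL (a # as) (d # ds) =
    map2 (*) (if a then [1,0,0,0,0,0,0,0,0,0,0,1] else [1,1,1,1,1,1,1,1,1,1,1,1])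
      (if d then suf (XL as ds) else tl (suf (XL as ds)) @ [0])"
| "XL (a # as) [] = (if a then [1,0,0,0,0,0,0,0,0,0,0,1] else [1,1,1,1,1,1,1,1,1,1,1,1])"
| "XL [] ds = []"

lemma suf: "length (suf xs) = length xs" "i < length xs \<Longrightarrow> suf xs ! i = (\<Sum>j\<in>{i..<length xs}. xs ! j)"
proof -
  have "suf xs = map (\<lambda>i. \<Sum>j\<in>{i..<length xs}. xs ! j) [0..<length xs]"
  proof (induction xs)
    case (Cons x xs)
    have sh: "(\<Sum>j\<in>{Suc i..<Suc (length xs)}. (x # xs) ! j) = (\<Sum>j\<in>{i..<length xs}. xs ! j)" for i
      by (simp only: sum.shift_bounds_Suc_ivl nth_Cons_Suc)
    have tl: "map (\<lambda>i. \<Sum>j\<in>{i..<length (x # xs)}. (x # xs) ! j) [0..<length (x # xs)] =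
      (\<Sum>j\<in>{0..<Suc (length xs)}. (x # xs) ! j) # suf xs"
      by (simp only: Cons.IH length_Cons map_upt_Suc sh)
    have hd: "(\<Sum>j\<in>{0..<Suc (length xs)}. (x # xs) ! j) = x + (\<Sum>j\<in>{0..<length xs}. xs ! j)"
      by (subst sum.atLeast0_lessThan_Suc_shift) (simp add: comp_def)
    show ?case
    proof (cases xs)
      case (Cons y ys)
      then have "suf xs = (\<Sum>j\<in>{0..<length xs}. xs ! j) # tl (suf xs)"
        unfolding Cons.IH by (simp add: upt_conv_Cons del: upt_Suc)
      then obtain s where "suf xs = (\<Sum>j\<in>{0..<length xs}. xs ! j) # s" by blast
      then show ?thesis unfolding tl hd by simp
    qed simp
  qed simp
  then show "length (suf xs) = length xs" "i < length xs \<Longrightarrow> suf xs ! i = (\<Sum>j\<in>{i..<length xs}. xs ! j)"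
    by simp_all
qed

lemma XL:
  assumes "length as = Suc k" "length ds = k"
  shows "XL as ds = map (\<lambda>c. \<Sum>cs\<in>nums k. of_bool (chain (c # cs) ds) * wprod as (c # cs)) [0..<12]"
  using assms
proof (induction k arbitrary: as ds)
  case 0
  then obtain a where "as = [a]" "ds = []" by (auto simp: length_Suc_conv)
  then show ?case by (simp add: cell_lists_0 wprod_def side_def upt_rec)
next
  case (Suc k)
  then obtain a as' d ds' where l: "as = a # as'" "ds = d # ds'" "length as' = Suc k" "length ds' = k"
    by (metis length_Suc_conv)
  let ?X = "XL as' ds'"
  have len: "length ?X = 12" using Suc.IH[OF l(3,4)] by simp
  let ?t = "if d then suf ?X else tl (suf ?X) @ [0]"
  have w: "(if a then [1,0,0,0,0,0,0,0,0,0,0,1] else [1,1,1,1,1,1,1,1,1,1,1,1]) =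
      map (\<lambda>c. if a then int (side c) else 1) [0..<12]"
    by (simp add: side_def upt_rec)
  \<comment> \<open>Both forms of \<open>?t\<close> sum \<open>?X\<close> over the columns
    \<open>c'\<close> to which a step from \<open>c\<close> may lead.\<close>
  have t: "?t ! c = (\<Sum>c'<12. of_bool (c < c' \<or> c = c' \<and> d) * ?X ! c')" if c: "c < 12" for c
  proof -
    have "(\<Sum>c'<12. of_bool (c < c' \<or> c = c' \<and> d) * ?X ! c') = (\<Sum>c'\<in>{c'. c' < 12 \<and> (c < c' \<or> c = c' \<and> d)}. ?X ! c')"
      by (rule sum.mono_neutral_cong_right) auto
    also have "{c'. c' < 12 \<and> (c < c' \<or> c = c' \<and> d)} = (if d then {c..<12} else {Suc c..<12})"
      using c by auto
    also have "(\<Sum>c'\<in>(if d then {c..<12} else {Suc c..<12}). ?X ! c') = ?t ! c"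
    proof (cases d)
      case False
      then show ?thesis using c len suf(1)[of ?X] suf(2)[of "Suc c" ?X]
        by (cases "Suc c < 12") (auto simp: nth_append nth_tl not_less_eq)
    qed (use c len suf(2)[of c ?X] in simp)
    finally show ?thesis by simp
  qed
  show ?case
  proof (rule nth_equalityI)
    show "length (XL as ds) = length (map (\<lambda>c. \<Sum>cs\<in>nums (Suc k). of_bool (chain (c # cs) ds) * wprod as (c # cs)) [0..<12])"
      using len suf(1)[of ?X] by (simp add: l)
    fix c assume "c < length (XL as ds)"
    then have c: "c < 12" using len suf(1)[of ?X] by (cases a) (simp_all add: l)
    have lt: "length ?t = 12" using len suf(1)[of ?X] by simp
    have "XL as ds ! c = (if a then int (side c) else 1) * (?t ! c)"
      unfolding l XL.simps(1) w using c lt by simp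
    also have "\<dots> = (\<Sum>c'<12. \<Sum>cs\<in>nums k. of_bool (chain (c # c' # cs) ds) * wprod as (c # c' # cs))"
      unfolding t[OF c] sum_distrib_left
    proof (rule sum.cong[OF refl])
      fix c' :: nat assume c': "c' \<in> {..<12}"
      have X: "?X ! c' = (\<Sum>cs\<in>nums k. of_bool (chain (c' # cs) ds') * wprod as' (c' # cs))"
        unfolding Suc.IH[OF l(3,4)] using c' by simp
      show "(if a then int (side c) else 1) * (of_bool (c < c' \<or> c = c' \<and> d) * ?X ! c') =
          (\<Sum>cs\<in>nums k. of_bool (chain (c # c' # cs) ds) * wprod as (c # c' # cs))"
        unfolding X sum_distrib_left
        by (rule sum.cong[OF refl]) (auto simp: l wprod_def)
    qed
    also have "\<dots> = (\<Sum>cs\<in>nums (Suc k). of_bool (chain (c # cs) ds) * wprod as (c # cs))"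
      by (simp add: sum_cell_lists_Suc)
    finally show "XL as ds ! c = map (\<lambda>c. \<Sum>cs\<in>nums (Suc k). of_bool (chain (c # cs) ds) * wprod as (c # cs)) [0..<12] ! c"
      using c by simp
  qed
qed

lemma XS_eq_XL:
  assumes "length as = Suc k" "length ds = k"
  shows "XS as ds = sum_list (XL as ds)"
proof -
  have "XS as ds = (\<Sum>c<12. \<Sum>cs\<in>nums k. of_bool (chain (c # cs) ds) * wprod as (c # cs))"
    by (simp add: XS_def assms sum_cell_lists_Suc)
  also have "\<dots> = sum_list (XL as ds)"
    unfolding XL[OF assms] by (simp add: interv_sum_list_conv_sum_set_nat lessThan_atLeast0)
  finally show ?thesis .
qed

section \<open>The counterexample\<close>

text \<open>Counts scaled by the factorial of the length convolve with a binomial coefficient. The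
  sum runs over a list to be executable.\<close>

definition conv_int :: "(nat \<Rightarrow> nat \<Rightarrow> bool) \<Rightarrow> (nat list \<Rightarrow> int) \<Rightarrow> (nat list \<Rightarrow> int) \<Rightarrow> nat list \<Rightarrow> int" where
  "conv_int R f g \<sigma> = sum_list (map (\<lambda>i. if separates R i \<sigma> then
      int (length \<sigma> choose i) * f (take i \<sigma>) * g (drop i \<sigma>) else 0) [0..<Suc (length \<sigma>)])"

definition mono_int :: "(nat \<Rightarrow> nat \<Rightarrow> bool) \<Rightarrow> int \<Rightarrow> nat list \<Rightarrow> int" where
  "mono_int R m \<sigma> = (if sorted_wrt R \<sigma> then m ^ length \<sigma> else 0)"

text \<open>
  Multiplication by \<open>k!\<close> makes the limiting counts of patterns of size \<open>k\<close> integers, which can be evaluated.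
\<close>

definition int_profile :: "(nat list \<Rightarrow> real) \<Rightarrow> (nat list \<Rightarrow> int) \<Rightarrow> bool" where
  "int_profile \<phi> f \<longleftrightarrow> (\<forall>\<sigma>. fact (length \<sigma>) * \<phi> \<sigma> = of_int (f \<sigma>))"

lemma int_profile_mono: "int_profile (mono_profile R (of_int m)) (mono_int R m)"
  by (simp add: int_profile_def mono_profile_def mono_int_def)

lemma int_profile_conv:
  assumes "int_profile \<phi> f" "int_profile \<psi> g"
  shows "int_profile (conv R \<phi> \<psi>) (conv_int R f g)"
  unfolding int_profile_def
proof
  fix \<sigma> :: "nat list"
  have "fact (length \<sigma>) * conv R \<phi> \<psi> \<sigma> = (\<Sum>i\<le>length \<sigma>. of_int (if separates R i \<sigma> then
      int (length \<sigma> choose i) * f (take i \<sigma>) * g (drop i \<sigma>) else 0))"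
    unfolding conv_def sum_distrib_left
  proof (rule sum.cong[OF refl])
    fix i assume "i \<in> {..length \<sigma>}"
    then have i: "i \<le> length \<sigma>" by simp
    have "fact i * \<phi> (take i \<sigma>) = of_int (f (take i \<sigma>))" "fact (length \<sigma> - i) * \<psi> (drop i \<sigma>) = of_int (g (drop i \<sigma>))"
      using assms[unfolded int_profile_def] i by (metis length_take min.absorb2, metis length_drop)
    then have "of_int (int (length \<sigma> choose i) * f (take i \<sigma>) * g (drop i \<sigma>)) =
        real (length \<sigma> choose i) * (fact i * \<phi> (take i \<sigma>)) * (fact (length \<sigma> - i) * \<psi> (drop i \<sigma>))"
      by simp
    also have "\<dots> = fact (length \<sigma>) * (\<phi> (take i \<sigma>) * \<psi> (drop i \<sigma>))"
      by (simp add: binomial_fact[OF i])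
    finally show "fact (length \<sigma>) * (if separates R i \<sigma> then \<phi> (take i \<sigma>) * \<psi> (drop i \<sigma>) else 0) =
        of_int (if separates R i \<sigma> then int (length \<sigma> choose i) * f (take i \<sigma>) * g (drop i \<sigma>) else 0)"
      by simp
  qed
  also have "\<dots> = of_int (conv_int R f g \<sigma>)"
    unfolding conv_int_def by (simp only: interv_sum_list_conv_sum_set_nat of_int_sum set_upt)
      (simp add: atLeast0LessThan lessThan_Suc_atMost)
  finally show "fact (length \<sigma>) * conv R \<phi> \<psi> \<sigma> = of_int (conv_int R f g \<sigma>)" .
qed

section \<open>The template, the core and their counts\<close>

definition layers :: "nat \<Rightarrow> (nat \<times> nat) set" where
  "layers j = dsum (incr j) (dsum (decr j) (dsum (decr (2 * j)) (dsum (decr j) (incr j))))"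

definition layers_int :: "nat list \<Rightarrow> int" where
  "layers_int = conv_int (<) (mono_int (<) 1) (conv_int (<) (mono_int (>) 1) (conv_int (<) (mono_int (>) 2)
    (conv_int (<) (mono_int (>) 1) (mono_int (<) 1))))"

lemma profile_layers: "\<exists>\<phi>. profile layers 6 \<phi> \<and> int_profile \<phi> layers_int"
proof -
  have one: "(\<lambda>j. real j / real j) \<longlonglongrightarrow> 1"
    by (rule Lim_transform_eventually[OF tendsto_const])
      (use eventually_gt_at_top[of 0] in \<open>auto elim: eventually_mono\<close>)
  have two: "(\<lambda>j. real (2 * j) / real j) \<longlonglongrightarrow> 2"
    using tendsto_mult[OF tendsto_const one, of 2] by (simp only: of_nat_mult of_nat_numeral times_divide_eq_right mult_1_right)
  show ?thesis
    using profile_dsum[OF profile_incr[OF one] profile_dsum[OF profile_decr[OF one] profile_dsum[OF profile_decr[OF two]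
      profile_dsum[OF profile_decr[OF one] profile_incr[OF one]]]]]
      int_profile_mono[of _ 1] int_profile_mono[of _ 2]
    by (auto simp: layers_def[abs_def] layers_int_def intro!: exI int_profile_conv)
qed

text \<open>
  The trie stores the values of \<open>XS\<close>, so that each of them is evaluated only once.
\<close>

datatype trie = Leaf int | Node trie trie

fun get :: "trie \<Rightarrow> bool list \<Rightarrow> int" where
  "get (Node l r) (b # bs) = get (if b then l else r) bs"
| "get (Leaf x) bs = x"
| "get t [] = 0"

fun mk :: "nat \<Rightarrow> (bool list \<Rightarrow> int) \<Rightarrow> trie" where
  "mk 0 f = Leaf (f [])"
| "mk (Suc n) f = Node (mk n (\<lambda>bs. f (True # bs))) (mk n (\<lambda>bs. f (False # bs)))"

lemma get_mk: "length bs = n \<Longrightarrow> get (mk n f) bs = f bs"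
  by (induction n arbitrary: bs f) (auto simp: length_Suc_conv)

text \<open>A key consists of the \<open>k + 1\<close> flags for the multiplicities followed by the
  \<open>k\<close> flags for the steps.\<close>

definition XS_trie :: "nat \<Rightarrow> trie" where
  "XS_trie k = mk (Suc (k + k)) (\<lambda>bs. sum_list (XL (take (Suc k) bs) (drop (Suc k) bs)))"

text \<open>The executable form of the sum over template patterns and cell lists; the trie is an
  argument so that it is built once and shared by all terms.\<close>

definition contract :: "trie \<Rightarrow> nat list \<Rightarrow> bool list list \<Rightarrow> nat list list \<Rightarrow> int" where
  "contract T \<tau> bl pl = sum_list (map (\<lambda>\<pi>. layers_int \<pi> * sum_list (map (\<lambda>\<alpha>. sum_list (map (\<lambda>as.
      coef as * get T (as @ adj \<alpha>) * get T (map ((!) as) \<tau> @ adj (map (\<lambda>i. \<pi> ! (\<alpha> ! i)) \<tau>))) bl)) pl)) pl)"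

text \<open>The argument is not the pattern but the list of its positions by increasing value, as in
  \<open>positions\<close>.\<close>

definition core_int :: "nat list \<Rightarrow> int" where
  "core_int \<tau> = contract (XS_trie (length \<tau> - 1)) \<tau> (List.n_lists (length \<tau>) [True, False])
    (permutations_of_set_list [0..<length \<tau>])"

text \<open>Mixed digits with bases 12, 12 and 8, hence the bound 1152 in
  \<open>core\<close>.\<close>

definition cell_index :: "nat \<times> nat \<times> nat \<Rightarrow> nat" where
  "cell_index w = (fst w * 12 + row w) * 8 + snd (snd w)"

definition core :: "nat \<Rightarrow> (nat \<times> nat) set" where
  "core j = tile fst row cell_index 1152 cells (layers j)"

text \<open>The values of \<open>\<sigma>\<close> need not be an initial segment: cutting patterns
  with \<open>take\<close> and \<open>drop\<close> leaves lists such as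
  \<open>[4, 2, 3]\<close>.\<close>

definition positions :: "nat list \<Rightarrow> nat list \<Rightarrow> bool" where
  "positions \<tau> \<sigma> \<longleftrightarrow> length \<tau> = length \<sigma> \<and> set \<tau> = {..<length \<sigma>} \<and> sorted_wrt (<) (map ((!) \<sigma>) \<tau>)"

lemma card_cells: "card cells = 1148"
proof -
  have "int (card cells) = (\<Sum>w\<in>cells. 1)" by simp
  also have "\<dots> = (\<Sum>c<12. \<Sum>r<12. (8 - int (side c) * int (side r)) * 1)"
    by (rule sum_cells)
  also have "\<dots> = 1148" by (simp add: numeral_eq_Suc side_def)
  finally show ?thesis by simp
qed

lemma cells_bounds: "w \<in> cells \<Longrightarrow> fst w < 12 \<and> row w < 12 \<and> snd (snd w) < 8"
  by (auto simp: cells_def)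

lemma inj_on_cell_index: "inj_on cell_index cells"
proof (rule inj_onI)
  fix w w' assume "w \<in> cells" "w' \<in> cells" and eq: "cell_index w = cell_index w'"
  then have "row w < 12" "snd (snd w) < 8" "row w' < 12" "snd (snd w') < 8" using cells_bounds by auto
  with eq have "fst w = fst w' \<and> row w = row w' \<and> snd (snd w) = snd (snd w')"
    unfolding cell_index_def by (simp only: digits_eq_iff simp_thms)
  then show "w = w'" by (simp add: prod_eq_iff)
qed

lemma cell_index_less: "w \<in> cells \<Longrightarrow> cell_index w < 1152"
  using cells_bounds[of w] by (simp add: cell_index_def)

lemma sum_set_distinct: "distinct xs \<Longrightarrow> (\<Sum>x\<in>set xs. f x) = sum_list (map f xs)"
  by (rule sum.distinct_set_conv_list)

text \<open>Combines the linearity in the template counts with the factored count of cell lists. A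
  nonempty pattern has one entry more than it has steps, the shape needed for
  \<open>XL\<close>.\<close>

lemma core_int:
  assumes \<phi>: "int_profile \<phi> layers_int" and \<tau>: "positions \<tau> \<sigma>" and ne: "\<sigma> \<noteq> []"
  shows "fact (length \<sigma>) * (\<Sum>\<pi>\<in>perms (length \<sigma>). \<phi> \<pi> * real (cell_count fst row cells \<sigma> \<pi>)) = of_int (core_int \<tau>)"
proof -
  define k where "k = length \<sigma> - 1"
  have k: "length \<sigma> = Suc k" using ne by (cases \<sigma>) (auto simp: k_def)
  have \<tau>': "length \<tau> = length \<sigma>" "set \<tau> = {..<length \<sigma>}" "sorted_wrt (<) (map ((!) \<sigma>) \<tau>)"
    using \<tau> by (auto simp: positions_def)
  let ?bl = "List.n_lists (length \<tau>) [True, False]" and ?pl = "permutations_of_set_list [0..<length \<tau>]"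
  have pl: "perms (length \<sigma>) = set ?pl" "distinct ?pl"
    using permutations_of_list[of "[0..<length \<tau>]"] distinct_permutations_of_set_list[of "[0..<length \<tau>]"] \<tau>'(1)
    by (simp_all add: lessThan_atLeast0)
  have bl: "bools (length \<sigma>) = set ?bl" "distinct ?bl"
    using \<tau>'(1) by (auto simp: cell_lists_def set_n_lists distinct_n_lists)
  have adj_len: "length (adj xs) = length xs - 1" for xs
    by (induction xs rule: adj.induct) auto
  have get: "get (XS_trie k) (as @ ds) = XS as ds" if "length as = Suc k" "length ds = k" for as ds
    using that k \<tau>'(1) by (simp add: XS_trie_def get_mk XS_eq_XL[OF that] del: mk.simps)
  have cc: "int (cell_count fst row cells \<sigma> \<pi>) = sum_list (map (\<lambda>\<alpha>. sum_list (map (\<lambda>as.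
      coef as * get (XS_trie (length \<tau> - 1)) (as @ adj \<alpha>) *
      get (XS_trie (length \<tau> - 1)) (map ((!) as) \<tau> @ adj (map (\<lambda>i. \<pi> ! (\<alpha> ! i)) \<tau>))) ?bl)) ?pl)" for \<pi>
  proof -
    have "int (cell_count fst row cells \<sigma> \<pi>) = (\<Sum>\<alpha>\<in>perms (length \<sigma>). \<Sum>as\<in>bools (length \<sigma>).
        coef as * XS as (adj \<alpha>) * XS (map ((!) as) \<tau>) (adj (map (\<lambda>i. \<pi> ! (\<alpha> ! i)) \<tau>)))"
      unfolding cell_count_def of_nat_sum
      by (rule sum.cong[OF refl], rule card_cell_cond[OF \<tau>']) (simp add: permsD)
    also have "\<dots> = (\<Sum>\<alpha>\<in>perms (length \<sigma>). \<Sum>as\<in>bools (length \<sigma>).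
      coef as * get (XS_trie (length \<tau> - 1)) (as @ adj \<alpha>) *
      get (XS_trie (length \<tau> - 1)) (map ((!) as) \<tau> @ adj (map (\<lambda>i. \<pi> ! (\<alpha> ! i)) \<tau>)))"
      by (intro sum.cong refl) (simp add: get adj_len permsD length_cell_lists k \<tau>'(1))
    finally show ?thesis unfolding pl(1) bl(1) sum_set_distinct[OF pl(2)] sum_set_distinct[OF bl(2)] .
  qed
  have "fact (length \<sigma>) * (\<Sum>\<pi>\<in>perms (length \<sigma>). \<phi> \<pi> * real (cell_count fst row cells \<sigma> \<pi>)) =
      (\<Sum>\<pi>\<in>perms (length \<sigma>). of_int (layers_int \<pi> * int (cell_count fst row cells \<sigma> \<pi>)))"
    unfolding sum_distrib_left
  proof (rule sum.cong[OF refl])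
    fix \<pi> assume "\<pi> \<in> perms (length \<sigma>)"
    then have "fact (length \<sigma>) * \<phi> \<pi> = of_int (layers_int \<pi>)"
      using \<phi>[unfolded int_profile_def, rule_format, of \<pi>] by (simp only: permsD(1))
    then show "fact (length \<sigma>) * (\<phi> \<pi> * real (cell_count fst row cells \<sigma> \<pi>)) =
        of_int (layers_int \<pi> * int (cell_count fst row cells \<sigma> \<pi>))" by (simp flip: mult.assoc)
  qed
  also have "\<dots> = of_int (core_int \<tau>)"
    unfolding of_int_sum[symmetric] core_int_def contract_def cc[symmetric] pl(1) sum_set_distinct[OF pl(2)] ..
  finally show ?thesis .
qed

text \<open>Divided by the power of 6888 given by the length, these are the limiting densities of
  12, 231, 312, 213, 1324, 4231, 2413 and 3142 in the core. The limit is symmetric in the diagonal,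
  which explains the two coincidences.\<close>

lemma core_int_values:
  "core_int [0, 1] = 23832144"
  "core_int [2, 0, 1] = 54343948938"
  "core_int [1, 2, 0] = 54343948938"
  "core_int [1, 0, 2] = 54753410970"
  "core_int [0, 2, 1, 3] = 94455978782136"
  "core_int [3, 1, 2, 0] = 91604307489672"
  "core_int [2, 0, 3, 1] = 94553260498080"
  "core_int [1, 3, 0, 2] = 94553260498080"
  by code_simp+

text \<open>The lists are what the four patterns leave in the core when they lose entries to the
  outer parts, together with 12, which refutes quasirandomness.\<close>

lemma profile_core:
  obtains \<phi> where "profile core 6888 \<phi>" "\<phi> [1, 2] = 23832144 / 2" "\<phi> [2, 3] = 23832144 / 2"
    "\<phi> [2, 3, 1] = 54343948938 / 6" "\<phi> [4, 2, 3] = 54343948938 / 6" "\<phi> [3, 2, 4] = 54753410970 / 6"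
    "\<phi> [1, 3, 2, 4] = 94455978782136 / 24" "\<phi> [4, 2, 3, 1] = 91604307489672 / 24"
    "\<phi> [2, 4, 1, 3] = 94553260498080 / 24" "\<phi> [3, 1, 4, 2] = 94553260498080 / 24"
proof -
  obtain \<phi> where \<phi>: "profile layers 6 \<phi>" "int_profile \<phi> layers_int" using profile_layers by blast
  let ?\<psi> = "\<lambda>\<sigma>. \<Sum>\<pi>\<in>perms (length \<sigma>). \<phi> \<pi> * real (cell_count fst row cells \<sigma> \<pi>)"
  have p: "profile core 6888 ?\<psi>"
    using profile_tile[OF finite_cells inj_on_cell_index cell_index_less \<phi>(1), of fst row] by (simp add: core_def[abs_def] card_cells)
  have v: "?\<psi> \<sigma> = of_int (core_int \<tau>) / fact (length \<sigma>)" if "positions \<tau> \<sigma>" "\<sigma> \<noteq> []" for \<tau> \<sigma>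
    using core_int[OF \<phi>(2) that] by (simp add: field_simps)
  have pos: "positions [0, 1] [1, 2]" "positions [0, 1] [2, 3]" "positions [2, 0, 1] [2, 3, 1]" "positions [1, 2, 0] [4, 2, 3]"
    "positions [1, 0, 2] [3, 2, 4]" "positions [0, 2, 1, 3] [1, 3, 2, 4]" "positions [3, 1, 2, 0] [4, 2, 3, 1]"
    "positions [2, 0, 3, 1] [2, 4, 1, 3]" "positions [1, 3, 0, 2] [3, 1, 4, 2]"
    by (auto simp: positions_def)
  have "?\<psi> [1, 2] = 23832144 / 2" "?\<psi> [2, 3] = 23832144 / 2"
    "?\<psi> [2, 3, 1] = 54343948938 / 6" "?\<psi> [4, 2, 3] = 54343948938 / 6" "?\<psi> [3, 2, 4] = 54753410970 / 6"
    "?\<psi> [1, 3, 2, 4] = 94455978782136 / 24" "?\<psi> [4, 2, 3, 1] = 91604307489672 / 24"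
    "?\<psi> [2, 4, 1, 3] = 94553260498080 / 24" "?\<psi> [3, 1, 4, 2] = 94553260498080 / 24"
    using pos[THEN v, OF list.distinct(2), unfolded core_int_values] by (simp_all add: fact_numeral)
  with p show thesis by (rule that)
qed

text \<open>The masses outside the core are real numbers; rounding the sizes down does not affect
  the limits.\<close>

lemma tendsto_nat_floor:
  assumes "0 \<le> (x::real)"
  shows "(\<lambda>j. real (nat \<lfloor>x * real j\<rfloor>) / real j) \<longlonglongrightarrow> x"
proof (rule tendsto_sandwich[where f = "\<lambda>j. x - 1 / real j" and h = "\<lambda>_. x"])
  have fl: "real (nat \<lfloor>x * real j\<rfloor>) = of_int \<lfloor>x * real j\<rfloor>" for j
    using assms by simp
  show "\<forall>\<^sub>F j in sequentially. x - 1 / real j \<le> real (nat \<lfloor>x * real j\<rfloor>) / real j"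
    using eventually_gt_at_top[of 0]
  proof eventually_elim
    case (elim j)
    have "x * real j - 1 \<le> of_int \<lfloor>x * real j\<rfloor>" by linarith
    then have "(x * real j - 1) / real j \<le> of_int \<lfloor>x * real j\<rfloor> / real j"
      by (rule divide_right_mono) simp
    then show ?case using elim unfolding fl by (simp add: diff_divide_distrib)
  qed
  show "\<forall>\<^sub>F j in sequentially. real (nat \<lfloor>x * real j\<rfloor>) / real j \<le> x"
    using eventually_gt_at_top[of 0]
  proof eventually_elim
    case (elim j)
    have "of_int \<lfloor>x * real j\<rfloor> \<le> x * real j" by linarith
    then show ?case using elim unfolding fl by (simp add: field_simps)
  qed
  show "(\<lambda>j. x - 1 / real j) \<longlonglongrightarrow> x"
    using tendsto_diff[OF tendsto_const lim_const_over_n, of x 1] by simp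
qed simp

lemma profile_nonneg: "profile A m \<phi> \<Longrightarrow> 0 \<le> \<phi> \<sigma>"
  by (rule LIMSEQ_le_const[of "\<lambda>j. real (occ (A j) \<sigma>) / real j ^ length \<sigma>"]) (auto simp: profile_def)

theorem theorem20:
  shows "\<not> quasirandom_forcing {[1,3,2,4], [2,4,1,3], [3,1,4,2], [4,2,3,1]}"
proof -
  obtain \<phi> where \<phi>: "profile core 6888 \<phi>" "\<phi> [1, 2] = 23832144 / 2" "\<phi> [2, 3] = 23832144 / 2"
    "\<phi> [2, 3, 1] = 54343948938 / 6" "\<phi> [4, 2, 3] = 54343948938 / 6" "\<phi> [3, 2, 4] = 54753410970 / 6"
    "\<phi> [1, 3, 2, 4] = 94455978782136 / 24" "\<phi> [4, 2, 3, 1] = 91604307489672 / 24"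
    "\<phi> [2, 4, 1, 3] = 94553260498080 / 24" "\<phi> [3, 1, 4, 2] = 94553260498080 / 24"
    by (rule profile_core)
  \<comment> \<open>\<open>c\<close> is the total mass, \<open>a\<close> the mass of \<open>R\<close>, and \<open>u\<close>, \<open>v\<close> are the masses of \<open>P\<close>, \<open>P'\<close>, with sum \<open>P\<close> and product \<open>Q\<close>;
    the core has mass 6888.\<close>
  define c where "c = root 4 2269278251953920"
  \<comment> \<open>Solves \<open>94455978782136 / 24 + a * (54753410970 / 6) = 94553260498080 /
    24\<close>, which gives 1324 the same count as 2413.\<close>
  define a where "a = (4053404831 / 9125568495 :: real)"
  define P where "P = c - 6888 - a"
  \<comment> \<open>Likewise solves the equation for 4231, in which \<open>P\<close> multiplies the
    count of 231 and \<open>Q\<close> that of 12 in the core.\<close>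
  define Q where "Q = (94553260498080 - 91604307489672 - 4 * P * 54343948938) / (12 * 23832144)"
  \<comment> \<open>The square root of the discriminant of \<open>x ^ 2 - P * x + Q\<close>, whose
    roots are \<open>u\<close> and \<open>v\<close>.\<close>
  define s where "s = sqrt (P\<^sup>2 - 4 * Q)"
  define u where "u = (P + s) / 2"
  define v where "v = (P - s) / 2"
  \<comment> \<open>The constant is \<open>24 * 94553260498080\<close>: the outer parts add no
    copies of 2413, so the total mass must turn its count into the density
    \<open>1 / 24\<close>.\<close>
  have c4: "c ^ 4 = 2269278251953920" and c0: "0 \<le> c" by (simp_all add: c_def)
  \<comment> \<open>\<open>P\<close> is a small difference of large masses, so \<open>c\<close> is
    located to within a thousandth.\<close>
  have "6901.952 ^ 4 < c ^ 4" unfolding c4 by (simp add: power4_eq_xxxx)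
  from power_less_imp_less_base[OF this c0] have c_lo: "6901.952 < c" .
  have "c ^ 4 < 6901.953 ^ 4" unfolding c4 by (simp add: power4_eq_xxxx)
  from power_less_imp_less_base[OF this] have c_hi: "c < 6901.953" by simp
  have P_lo: "13.5078 < P" and P_hi: "P < 13.509" using c_lo c_hi by (simp_all add: P_def a_def)
  have "13.5078\<^sup>2 \<le> P\<^sup>2" by (rule power_mono[OF less_imp_le[OF P_lo]]) simp
  \<comment> \<open>\<open>Q\<close> decreases as \<open>P\<close> grows, so the lower bound on
    \<open>P\<close> bounds \<open>Q\<close> from above and the upper bound on \<open>P\<close>
    keeps it nonnegative.\<close>
  moreover have "4 * Q \<le> 13.5078\<^sup>2" "0 \<le> Q"
    using P_lo P_hi c_lo by (simp_all add: Q_def P_def a_def field_simps power2_eq_square)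
  ultimately have disc: "0 \<le> P\<^sup>2 - 4 * Q" and Q0: "0 \<le> Q" by simp_all
  have s: "0 \<le> s" "s\<^sup>2 = P\<^sup>2 - 4 * Q" using disc by (simp_all add: s_def)
  have "s\<^sup>2 \<le> P\<^sup>2" unfolding s(2) using Q0 by simp
  then have "s \<le> P" by (rule power2_le_imp_le) (use P_lo in simp)
  then have uv0: "0 \<le> u" "0 \<le> v" using s P_lo by (simp_all add: u_def v_def)
  have uv: "u + v = P" by (simp add: u_def v_def field_simps)
  have "u * v = (P\<^sup>2 - s\<^sup>2) / 4" by (simp add: u_def v_def field_simps power2_eq_square)
  then have uvQ: "u * v = Q" using s by simp
  have a0: "0 \<le> a" by (simp add: a_def)
  let ?A = "\<lambda>j. dsum (incr (nat \<lfloor>a * real j\<rfloor>))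
    (ssum (decr (nat \<lfloor>u * real j\<rfloor>)) (ssum (core j) (decr (nat \<lfloor>v * real j\<rfloor>))))"
  let ?\<psi> = "conv (<) (mono_profile (<) a) (conv (>) (mono_profile (>) u) (conv (>) \<phi> (mono_profile (>) v)))"
  have "a + (u + (6888 + v)) = c" using uv by (simp add: P_def)
  then have prof: "profile ?A c ?\<psi>"
    using profile_dsum[OF profile_incr[OF tendsto_nat_floor[OF a0]] profile_ssum[OF profile_decr[OF tendsto_nat_floor[OF uv0(1)]]
      profile_ssum[OF \<phi>(1) profile_decr[OF tendsto_nat_floor[OF uv0(2)]]]]] by simp
  note eval = conv_def mono_profile_def separates_def \<phi> \<phi>[simplified] fact_numeral
  have "?\<psi> [2, 4, 1, 3] = 94553260498080 / 24" by (simp add: eval)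
  moreover have "?\<psi> [3, 1, 4, 2] = 94553260498080 / 24" by (simp add: eval)
  \<comment> \<open>1324 splits as a direct sum after its first or third entry; 132 is not
    increasing, so only the first cut adds a term, with 324 left in the core.\<close>
  moreover have "?\<psi> [1, 3, 2, 4] = 94455978782136 / 24 + a * (54753410970 / 6)" by (simp add: eval)
  then have "?\<psi> [1, 3, 2, 4] = 94553260498080 / 24" by (simp add: a_def)
  \<comment> \<open>4231 may lose its 4 to the first decreasing part, its 1 to the second, or both.
    The cores of the first two cases, 231 and 423, have equal counts, so only \<open>u + v\<close>
    and \<open>u * v\<close> enter.\<close>
  moreover have "?\<psi> [4, 2, 3, 1] = 91604307489672 / 24 + (u + v) * (54343948938 / 6) + (u * v) * (23832144 / 2)"
    by (simp add: eval algebra_simps)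
  then have "?\<psi> [4, 2, 3, 1] = 94553260498080 / 24" unfolding uv uvQ by (simp add: Q_def field_simps)
  ultimately have eq: "?\<psi> \<sigma> * fact (length \<sigma>) / c ^ length \<sigma> = 1 / fact (length \<sigma>)"
    if "\<sigma> \<in> {[1,3,2,4], [2,4,1,3], [3,1,4,2], [4,2,3,1]}" for \<sigma>
    using that c4 by (auto simp: fact_numeral power4_eq_xxxx mult.assoc)
  \<comment> \<open>The copies of 12 inside the core alone already give a density above
    \<open>1 / 2\<close> relative to the total mass \<open>c\<close>, and the outer parts only add
    further copies.\<close>
  have "23832144 / 2 \<le> ?\<psi> [1, 2]"
    using profile_nonneg[OF \<phi>(1)] a0 uv0 by (simp add: eval)
  moreover have "c\<^sup>2 \<le> 6901.953\<^sup>2" using c_hi c0 by (intro power_mono) simp_all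
  then have "c\<^sup>2 < 2 * 23832144" by (simp add: power2_eq_square)
  ultimately have ne: "?\<psi> [1, 2] * fact (length [1, 2::nat]) / c ^ length [1, 2::nat] \<noteq> 1 / fact (length [1, 2::nat])"
    using c_lo by (simp add: fact_numeral field_simps power2_eq_square)
  have "is_permutation [1, 2]"
    by (auto simp: is_permutation_def permutations_of_set_def)
  moreover have "0 < c" using c_lo by simp
  ultimately show ?thesis
    using not_quasirandom_forcing_if_profile[OF prof _ eq _ ne] by blast
qed

end
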